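(* Let $X$ be a finite dimensional real or complex Banach space, let $\mu$ be an admissible probability measure on $S_X$ and let $\eta$ be an admissible probability measure on $S_{X^*}$. Then there exist $\psi_0\in S_{X^*}$ and $x_0\in S_X$ (depending on $\mu$ and $\eta$) such that $$\exp\left\{-\int_{S_{X^*}} \log |\langle x_0,\psi\rangle | \,d\eta(\psi)\right\} \leq \mathbf c(X) \leq \exp\left\{-\int_{S_X} \log |\langle x,\psi_0\rangle |\, d\mu(x)\right\}.$$
   Context: For a Banach space $Y$, $B_Y$ and $S_Y$ denote its closed unit ball and unit sphere. For a Banach space $X$ over $\mathbb K\in\{\mathbb R,\mathbb C\}$ and $n\in\mathbb N$, the $n$th linear polarization constant $\mathbf c_n(X)$ is the smallest constant such that for all $\psi_1,\dots,\psi_n\in X^*$, $\|\psi_1\|\cdots\|\psi_n\|\le \mathbf c_n(X)\,\|\psi_1\cdots\psi_n\|$, where $\psi_1\cdots\psi_n$ is the pointwise product and $\|P\|=\sup_{x\in S_X}|P(x)|$. The linear polarization constant is $\mathbf c(X)=\lim_{n\to\infty}\mathbf c_n(X)^{1/n}$ (this limit exists). Admissibility: let $Y$ be a Banach space, $K\subseteq B_Y$ a Borel set and $\lambda$ a Borel measure on $K$. $\lambda$ is admissible if $\int_K\log|\langle y,\varphi\rangle|\,d\lambda(y)$ is finite for every $\varphi\in S_{Y^*}$ and the functions $g_m(\varphi)=\int_K\max\{\log|\langle y,\varphi\rangle|,-m\}\,d\lambda(y)$ converge uniformly on $S_{Y^*}$, as $m\to\infty$, to $g(\varphi)=\int_K\log|\langle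 y,\varphi\rangle|\,d\lambda(y)$. For a measure on $S_{X^*}$ this is applied with $Y=X^*$ (so $Y^*=X$, $X$ being finite dimensional). *)

theory Defs
  imports "HOL-Analysis.Analysis" "HOL-Probability.Probability"
begin

text \<open>The scalar field K is a type of class real_normed_field (i.e. R or C).
  An n-dimensional Banach space X over K is modelled as K^n with an arbitrary norm N.
  A functional in X^* is represented by a vector psi in K^n, acting via the bilinear
  pairing below; X^* carries the dual norm.\<close>

definition pair :: "'k::real_normed_field ^ 'n \<Rightarrow> 'k ^ 'n \<Rightarrow> 'k" where
  "pair x \<psi> = (\<Sum>i\<in>UNIV. x $ i * \<psi> $ i)"

definition is_norm :: "('k::real_normed_field ^ 'n \<Rightarrow> real) \<Rightarrow> bool" where
  "is_norm N \<longleftrightarrow> (\<forall>x. 0 \<le> N x) \<and> (\<forall>x. N x = 0 \<longleftrightarrow> x = 0)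
     \<and> (\<forall>c x. N (c *s x) = norm c * N x) \<and> (\<forall>x y. N (x + y) \<le> N x + N y)"

definition unit_sphere :: "('k::real_normed_field ^ 'n \<Rightarrow> real) \<Rightarrow> ('k ^ 'n) set" where
  "unit_sphere N = {x. N x = 1}"

definition unit_ball :: "('k::real_normed_field ^ 'n \<Rightarrow> real) \<Rightarrow> ('k ^ 'n) set" where
  "unit_ball N = {x. N x \<le> 1}"

definition dualnorm :: "('k::real_normed_field ^ 'n \<Rightarrow> real) \<Rightarrow> 'k ^ 'n \<Rightarrow> real" where
  "dualnorm N \<psi> = (SUP x\<in>unit_sphere N. norm (pair x \<psi>))"

definition prod_norm :: "('k::real_normed_field ^ 'n \<Rightarrow> real) \<Rightarrow> nat \<Rightarrow> (nat \<Rightarrow> 'k ^ 'n) \<Rightarrow> real" where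
  "prod_norm N n \<psi> = (SUP x\<in>unit_sphere N. norm (\<Prod>i<n. pair x (\<psi> i)))"

definition lin_pol_const :: "('k::real_normed_field ^ 'n \<Rightarrow> real) \<Rightarrow> nat \<Rightarrow> real" where
  "lin_pol_const N n = Inf {c. \<forall>\<psi>::nat \<Rightarrow> 'k ^ 'n.
       (\<Prod>i<n. dualnorm N (\<psi> i)) \<le> c * prod_norm N n \<psi>}"

definition pol_const :: "('k::real_normed_field ^ 'n \<Rightarrow> real) \<Rightarrow> real" where
  "pol_const N = lim (\<lambda>n. lin_pol_const N n powr (1 / real n))"

definition neglog :: "real \<Rightarrow> ennreal" where
  "neglog t = (if t = 0 then \<infinity> else ennreal (- ln t))"

text \<open>Admissibility of a Borel measure lam on K \<subseteq> B_Y, where Y = K^n with norm NY,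
  and Y^* is identified with K^n (via pair) carrying the dual norm of NY.
  The integral of log|<y,phi>| is -(integral of neglog), and the integral of
  max{log|<y,phi>|, -m} is -(integral of min{neglog, m}).\<close>
definition admissible :: "('k::real_normed_field ^ 'n \<Rightarrow> real) \<Rightarrow> ('k ^ 'n) set \<Rightarrow> ('k ^ 'n) measure \<Rightarrow> bool" where
  "admissible NY K lam \<longleftrightarrow>
     K \<in> sets borel \<and> K \<subseteq> unit_ball NY \<and> sets lam = sets (restrict_space borel K) \<and>
     (\<forall>\<phi>\<in>unit_sphere (dualnorm NY). (\<integral>\<^sup>+ y. neglog (norm (pair y \<phi>)) \<partial>lam) < \<infinity>) \<and>
     uniform_limit (unit_sphere (dualnorm NY))
       (\<lambda>m \<phi>. - enn2real (\<integral>\<^sup>+ y. min (neglog (norm (pair y \<phi>))) (of_nat m) \<partial>lam))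
       (\<lambda>\<phi>. - enn2real (\<integral>\<^sup>+ y. neglog (norm (pair y \<phi>)) \<partial>lam))
       sequentially"

end

theory Submission
  imports Defs "HOL-Computational_Algebra.Fundamental_Theorem_Algebra"
begin

text \<open>By admissibility the logarithmic potentials of \<open>\<mu>\<close> and \<open>\<eta>\<close> are continuous on the (compact) unit
  spheres. Take for \<open>\<psi>\<^sub>0\<close> a minimiser of the potential of \<open>\<mu>\<close> and for \<open>x\<^sub>0\<close> a maximiser of the potential
  of \<open>\<eta>\<close>. Integrating \<open>ln \<bar>\<psi>\<^sub>1 \<cdots> \<psi>\<^sub>n\<bar>\<close> against \<open>\<mu>\<close> bounds \<open>c\<^sub>n\<close> from above. For the lower bound,
  approximate \<open>\<eta>\<close>, tested on the truncated logarithms, by the normalised counting measure of \<open>n\<close> functionals,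
  uniformly on the sphere. The limit defining the polarization constant exists because \<open>c\<^sub>n c\<^sub>m \<le> c\<^sub>n\<^sub>+\<^sub>m\<close>.
  Compactness needs that a real normed field is \<open>\<real>\<close> or \<open>\<complex>\<close> (Ostrowski).\<close>

section \<open>Real normed fields\<close>

text \<open>The two estimates are not independent. The upper one shows through \<mu> that bounds for
  c_n exist at all, and only then does the infimum defining c_n carry meaning and can be estimated
  from below. The uniformity in the definition of admissibility works twice. It transfers continuity
  from the truncated potentials to the true ones, and it lets one truncation level \<open>m\<close>
  serve every point of the sphere in the discretisation. At that level the integrand is bounded by
  \<open>m\<close> and Lipschitz with constant \<open>exp m\<close>, so a finite net of functionals
  suffices, and rounding the multiplicities to integers costs at most \<open>m\<close> per cell.
  This loss does not grow with n and vanishes in the n-th root. Rounding down produces only some n'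
  \<le> n functionals; monotonicity of c_n absorbs the difference.\<close>

lemma map_poly_of_real_add:
  "map_poly (of_real :: real \<Rightarrow> 'a::real_algebra_1) (p + q) = map_poly of_real p + map_poly of_real q"
  by (rule poly_eqI) (simp add: coeff_map_poly)

lemma map_poly_of_real_mult:
  "map_poly (of_real :: real \<Rightarrow> 'a::{real_algebra_1,comm_ring_1}) (p * q)
    = map_poly of_real p * map_poly of_real q"
  by (rule poly_eqI) (simp add: coeff_map_poly coeff_mult)

lemma map_poly_of_real_power:
  "map_poly (of_real :: real \<Rightarrow> 'a::{real_algebra_1,comm_ring_1}) (p ^ n) = map_poly of_real p ^ n"
  by (induction n) (simp_all add: map_poly_of_real_mult)

text \<open>The real polynomial \<open>(X - w) (X - cnj w)\<close>.\<close>

definition conj_quad :: "complex \<Rightarrow> real poly" where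
  "conj_quad w = [:(cmod w)\<^sup>2, - 2 * Re w, 1:]"

lemma degree_conj_quad [simp]: "degree (conj_quad w) = 2"
  and lead_coeff_conj_quad [simp]: "coeff (conj_quad w) 2 = 1"
  by (simp_all add: conj_quad_def numeral_2_eq_2)

lemma poly_conj_quad:
  "poly (map_poly of_real (conj_quad w)) (z :: 'k::real_field)
    = z\<^sup>2 - of_real (2 * Re w) * z + of_real ((cmod w)\<^sup>2)"
  by (simp add: conj_quad_def map_poly_pCons algebra_simps power2_eq_square)

lemma conj_quad_of_real:
  "poly (map_poly of_real (conj_quad (of_real a))) (z :: 'k::real_field) = (z - of_real a)\<^sup>2"
  unfolding poly_conj_quad by (simp add: algebra_simps power2_eq_square)

lemma conj_quad_root: "poly (map_poly of_real (conj_quad w)) w = (0::complex)"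
  unfolding poly_conj_quad unfolding cmod_power2
  by (simp add: complex_eq_iff power2_eq_square algebra_simps)

text \<open>The remainder of the division is a real polynomial of degree at most 1, and a nonzero
  one cannot vanish at a non-real point.\<close>

lemma conj_quad_dvd:
  fixes P :: "real poly"
  assumes r: "poly (map_poly of_real P) w = (0::complex)" and im: "Im w \<noteq> 0"
  shows "conj_quad w dvd P"
proof -
  define R where "R = P mod conj_quad w"
  have P: "P = (P div conj_quad w) * conj_quad w + R" by (simp add: R_def)
  have "poly (map_poly of_real P) w = poly (map_poly of_real R) w"
    by (subst P) (simp add: map_poly_of_real_add map_poly_of_real_mult conj_quad_root)
  hence rR: "poly (map_poly of_real R) w = 0" using r by simp
  have "conj_quad w \<noteq> 0" by (simp add: conj_quad_def)
  hence "R = 0 \<or> degree R < 2" using degree_mod_less[of "conj_quad w" P] by (simp add: R_def)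
  hence d: "degree R \<le> 1" by auto
  obtain a R' where R': "R = pCons a R'" by (rule pCons_cases)
  with d have "degree R' = 0" by (auto split: if_splits)
  then obtain b where R: "R = [:a, b:]" using R' by (auto elim: degree_eq_zeroE)
  have "of_real a + w * of_real b = 0" using rR by (simp add: R map_poly_pCons)
  hence "b = 0 \<and> a = 0" using im by (auto simp: complex_eq_iff)
  hence "R = 0" using R by simp
  thus ?thesis by (simp add: R_def dvd_eq_mod_eq_0)
qed

text \<open>Over the reals \<open>P\<close> splits into linear factors and factors
  \<open>conj_quad w\<close>. The latter have norm at least \<open>m\<close> at \<open>z\<close>;
  the square of a linear factor is \<open>conj_quad\<close> of a real point, so it has norm at least
  \<open>m\<close> as well. Squaring the norm of \<open>P\<close> avoids square roots of
  \<open>m\<close>.\<close>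

lemma monic_poly_lower_bound:
  fixes z :: "'k::real_normed_field"
  assumes m: "\<And>w. m \<le> norm (poly (map_poly of_real (conj_quad w)) z)" and m0: "0 \<le> m"
  shows "lead_coeff P = 1 \<Longrightarrow> m ^ degree P \<le> (norm (poly (map_poly of_real P) z))\<^sup>2"
proof (induction "degree P" arbitrary: P rule: less_induct)
  case less
  let ?e = "\<lambda>P. poly (map_poly of_real P) z"
  have P0: "P \<noteq> 0" using less.prems by auto
  show ?case
  proof (cases "degree P = 0")
    case True
    then obtain a where "P = [:a:]" using degree_eq_zeroE by blast
    thus ?thesis using less.prems by (simp add: map_poly_pCons)
  next
    case False
    have "degree (map_poly complex_of_real P) = degree P"
      by (rule degree_map_poly) simp
    hence "\<not> constant (poly (map_poly complex_of_real P))"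
      using False by (simp add: constant_degree)
    then obtain w where w: "poly (map_poly of_real P) w = (0::complex)"
      using fundamental_theorem_of_algebra by blast
    show ?thesis
    proof (cases "Im w = 0")
      case True
      hence wr: "w = of_real (Re w)" by (simp add: complex_eq_iff)
      have "complex_of_real (poly P (Re w)) = poly (map_poly of_real P) (of_real (Re w))"
        by (induction P) (simp_all add: map_poly_pCons)
      hence "poly P (Re w) = 0" using w wr by (metis of_real_eq_0_iff)
      then obtain Q where Q: "P = [:- Re w, 1:] * Q" by (auto simp: poly_eq_0_iff_dvd)
      have Q0: "Q \<noteq> 0" using P0 Q by auto
      have d: "degree P = Suc (degree Q)" unfolding Q using Q0 by (subst degree_mult_eq) auto
      have "lead_coeff Q = 1" using less.prems unfolding Q by (subst (asm) lead_coeff_mult) simp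
      hence "m ^ degree Q \<le> (norm (?e Q))\<^sup>2" using less.hyps d by simp
      moreover have "m \<le> (norm (z - of_real (Re w)))\<^sup>2"
        using m[of "of_real (Re w)"] by (simp add: conj_quad_of_real norm_power)
      moreover have "?e P = (z - of_real (Re w)) * ?e Q"
        unfolding Q map_poly_of_real_mult by (simp add: map_poly_pCons algebra_simps)
      ultimately show ?thesis using m0
        by (simp add: d norm_mult power_mult_distrib) (rule mult_mono, auto)
    next
      case False
      then obtain Q where Q: "P = conj_quad w * Q" using conj_quad_dvd[OF w] by (auto elim: dvdE)
      have Q0: "Q \<noteq> 0" using P0 Q by auto
      have d: "degree P = 2 + degree Q" unfolding Q using Q0
        by (subst degree_mult_eq) (auto simp: conj_quad_def)
      have "lead_coeff Q = 1" using less.prems unfolding Q by (subst (asm) lead_coeff_mult) simp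
      hence "m ^ degree Q \<le> (norm (?e Q))\<^sup>2" using less.hyps d by simp
      moreover have "m\<^sup>2 \<le> (norm (?e (conj_quad w)))\<^sup>2"
        using m m0 by (intro power_mono)
      ultimately show ?thesis using m0
        unfolding d power_add by (simp add: Q map_poly_of_real_mult norm_mult power_mult_distrib mult_mono)
    qed
  qed
qed

text \<open>Ostrowski's argument: at a minimiser of largest modulus, a positive minimum could be
  pushed outwards.\<close>

lemma real_normed_field_quadratic:
  fixes z :: "'k::real_normed_field"
  shows "\<exists>w. poly (map_poly of_real (conj_quad w)) z = 0"
proof -
  define e where "e = (\<lambda>P. poly (map_poly of_real P) z)"
  define f where "f = (\<lambda>w. norm (e (conj_quad w)))"
  have f_eq: "f w = norm (z\<^sup>2 - of_real (2 * Re w) * z + of_real ((cmod w)\<^sup>2))" for w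
    by (simp add: f_def e_def poly_conj_quad)
  have cont: "continuous_on A f" for A
    unfolding f_eq by (intro continuous_intros)
  \<comment> \<open>Quadratic growth in \<open>w\<close>, which confines the search for a minimum to
    a compact disc.\<close>
  have grow: "(cmod w)\<^sup>2 - 2 * cmod w * norm z - (norm z)\<^sup>2 \<le> f w" for w
  proof -
    have "norm (of_real ((cmod w)\<^sup>2) :: 'k) \<le> f w + norm (of_real (2 * Re w) * z) + norm (z\<^sup>2)"
      unfolding f_eq by norm
    moreover have "norm (of_real (2 * Re w) * z) \<le> 2 * cmod w * norm z"
      using abs_Re_le_cmod[of w] by (auto simp: norm_mult intro!: mult_right_mono)
    ultimately show ?thesis by (simp add: norm_power)
  qed
  \<comment> \<open>Chosen so that at modulus \<open>R\<close> the lower bound \<open>grow\<close>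
    already exceeds \<open>f 0\<close>; no point outside the disc can then be a minimiser.\<close>
  define R where "R = 3 * norm z + f 0 + 1"
  have f0: "f w \<ge> 0" for w by (simp add: f_def)
  have R1: "R \<ge> 1" "R - 2 * norm z \<ge> 0" using f0[of 0] norm_ge_zero[of z] unfolding R_def by linarith+
  have far: "f w > f 0" if "cmod w > R" for w
  proof -
    have "R * (R - 2 * norm z) < cmod w * (cmod w - 2 * norm z)"
      using that R1 by (intro mult_strict_mono) linarith+
    moreover have "R * (R - 2 * norm z) - (norm z)\<^sup>2
        = 2 * (norm z)\<^sup>2 + 4 * norm z * f 0 + 4 * norm z + (f 0)\<^sup>2 + 2 * f 0 + 1"
      by (simp add: R_def algebra_simps power2_eq_square)
    moreover have "cmod w * (cmod w - 2 * norm z) = (cmod w)\<^sup>2 - 2 * cmod w * norm z"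
      by (simp add: algebra_simps power2_eq_square)
    ultimately show ?thesis
      using grow[of w] f0[of 0] zero_le_power2[of "norm z"] zero_le_power2[of "f 0"] norm_ge_zero[of z]
        mult_nonneg_nonneg[OF norm_ge_zero[of z] f0[of 0]] by linarith
  qed
  have "cball (0::complex) R \<noteq> {}" using R1 by simp
  then obtain v where v: "v \<in> cball 0 R" "\<And>w. w \<in> cball 0 R \<Longrightarrow> f v \<le> f w"
    using continuous_attains_inf[OF compact_cball _ cont] by blast
  define m where "m = f v"
  have m: "m \<le> f w" for w
  proof (cases "cmod w \<le> R")
    case False
    moreover have "0 \<in> cball (0::complex) R" using R1 by simp
    ultimately show ?thesis using far[of w] v(2)[of 0] by (simp add: m_def)
  qed (use v in \<open>auto simp: m_def\<close>)
  have m0: "m \<ge> 0" using f0 by (simp add: m_def)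
  show ?thesis
  proof (cases "m = 0")
    case True
    thus ?thesis by (auto simp: m_def f_def e_def)
  next
    case False
    hence mpos: "m > 0" using m0 by simp
    define S where "S = {w. f w = m}"
    have "S \<subseteq> cball 0 R"
    proof
      fix w assume "w \<in> S"
      hence "f w \<le> f 0" using m by (auto simp: S_def)
      thus "w \<in> cball 0 R" using far[of w] by force
    qed
    moreover have "closed S" unfolding S_def
      by (intro closed_Collect_eq cont continuous_on_const)
    ultimately have "compact S"
      by (metis bounded_cball bounded_subset compact_eq_bounded_closed)
    moreover have "v \<in> S" by (simp add: S_def m_def)
    ultimately obtain w0 where w0: "w0 \<in> S" "\<And>w. w \<in> S \<Longrightarrow> cmod w \<le> cmod w0"
      using continuous_attains_sup[of S cmod] continuous_on_norm_id by blast
    define \<epsilon> where "\<epsilon> = m / 2"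
    \<comment> \<open>Keeping the real part and raising the squared modulus by \<epsilon> adds
      exactly the constant \<epsilon> to the quadratic. As \<open>w1\<close> lies farther out than
      \<open>w0\<close>, it is not in \<open>S\<close>.\<close>
    define w1 where "w1 = Complex (Re w0) (sqrt ((Im w0)\<^sup>2 + \<epsilon>))"
    have eps: "\<epsilon> > 0" using mpos by (simp add: \<epsilon>_def)
    have n1: "(cmod w1)\<^sup>2 = (cmod w0)\<^sup>2 + \<epsilon>"
      unfolding cmod_power2 w1_def using eps by simp
    have q1: "conj_quad w1 = conj_quad w0 - [:-\<epsilon>:]"
      by (simp add: conj_quad_def n1) (simp add: w1_def)
    have "(cmod w0)\<^sup>2 < (cmod w1)\<^sup>2" using n1 eps by simp
    hence "cmod w0 < cmod w1" by (rule power_less_imp_less_base) simp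
    hence "w1 \<notin> S" using w0(2) by force
    hence gt: "m < f w1" using m[of w1] by (simp add: S_def)
    \<comment> \<open>With g = \<open>conj_quad w0\<close> and c = -\<epsilon>, the difference of
      the powers of g and c is divisible by g - c, which is \<open>conj_quad w1\<close>. The
      cofactor \<open>H\<close> is monic of degree 2n, hence of norm at least \<open>m ^ n\<close>
      at \<open>z\<close>, while the whole product has norm at most
      \<open>m ^ Suc n + \<epsilon> ^ Suc n\<close>. Since \<epsilon> is half of \<open>m\<close>,
      the quotient tends to \<open>m\<close>.\<close>
    have le: "f w1 \<le> m * (1 + (1/2) ^ Suc n)" for n
    proof -
      let ?g = "conj_quad w0" and ?c = "[:-\<epsilon>:]"
      define G where "G = ?g ^ Suc n - ?c ^ Suc n"
      obtain H where H: "G = conj_quad w1 * H"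
        unfolding G_def power_diff_sumr2 q1 by blast
      have dg: "degree (?g ^ Suc n) = 2 * Suc n"
        by (subst degree_power_eq) (auto simp: conj_quad_def)
      have dc: "degree (?c ^ Suc n) = 0"
        by (metis degree_pCons_0 degree_power_le le_zero_eq mult_zero_left)
      have dG: "degree G = 2 * Suc n" 
        unfolding G_def diff_conv_add_uminus using dg dc by (subst degree_add_eq_left) auto
      have lG: "lead_coeff G = 1"
      proof -
        have "lead_coeff G = lead_coeff (?g ^ Suc n)"
          using lead_coeff_add_le[of "- (?c ^ Suc n)" "?g ^ Suc n"] dg dc
          unfolding G_def degree_minus by (simp only: uminus_add_conv_diff zero_less_Suc nat_0_less_mult_iff zero_less_numeral)
        thus ?thesis unfolding lead_coeff_power by (simp only: degree_conj_quad lead_coeff_conj_quad power_one)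
      qed
      have H0: "H \<noteq> 0" using lG H by auto
      have "degree G = 2 + degree H" unfolding H using H0
        by (subst degree_mult_eq) (auto simp: conj_quad_def)
      hence dH: "degree H = n * 2" using dG by simp
      have "lead_coeff H = 1" using lG unfolding H by (subst (asm) lead_coeff_mult) simp
      hence "m ^ degree H \<le> (norm (e H))\<^sup>2"
        unfolding e_def using m m0 by (intro monic_poly_lower_bound) (auto simp: f_def e_def)
      hence "(m ^ n)\<^sup>2 \<le> (norm (e H))\<^sup>2" by (simp add: dH power_mult)
      hence mH: "m ^ n \<le> norm (e H)" by (rule power2_le_imp_le) simp
      have "f w1 * m ^ n \<le> f w1 * norm (e H)" using mH f0 by (intro mult_left_mono)
      also have "\<dots> = norm (e G)" by (simp add: H e_def f_def map_poly_of_real_mult norm_mult)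
      also have "e G = e ?g ^ Suc n + - (of_real (- \<epsilon>) ^ Suc n)"
      proof -
        have "e (G + ?c ^ Suc n) = e (?g ^ Suc n)" by (simp add: G_def)
        hence "e G + of_real (- \<epsilon>) ^ Suc n = e ?g ^ Suc n"
          unfolding e_def map_poly_of_real_add map_poly_of_real_power poly_add poly_power
          by (simp add: map_poly_pCons)
        thus ?thesis by (simp add: algebra_simps)
      qed
      also have "norm \<dots> \<le> norm (e ?g ^ Suc n) + norm (- (of_real (- \<epsilon>) ^ Suc n :: 'k))"
        by (rule norm_triangle_ineq)
      also have "\<dots> = m ^ Suc n + \<epsilon> ^ Suc n"
        using w0(1) eps unfolding norm_minus_cancel norm_power by (simp add: S_def f_def)
      also have "\<dots> = m * (1 + (1/2) ^ Suc n) * m ^ n"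
        by (simp add: \<epsilon>_def power_divide field_simps)
      finally show ?thesis using mpos by (simp add: mult_le_cancel_right)
    qed
    have "(\<lambda>n. m * (1 + (1/2) ^ Suc n)) \<longlonglongrightarrow> m * (1 + 0)"
      by (intro tendsto_intros LIMSEQ_Suc LIMSEQ_power_zero) auto
    hence "f w1 \<le> m * (1 + 0)" using le by (intro LIMSEQ_le_const) auto
    thus ?thesis using gt by simp
  qed
qed

text \<open>The scalar field is \<open>\<real> + \<real>e\<close>, with \<open>e = 0\<close> or \<open>e\<^sup>2 = -1\<close>.\<close>

lemma real_normed_field_coordinates:
  "\<exists>e::'k::real_normed_field. \<forall>x. \<exists>w. x = of_real (Re w) + of_real (Im w) * e \<and> cmod w \<le> 2 * norm x"
proof (cases "\<forall>x::'k. x \<in> \<real>")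
  case True
  show ?thesis
  proof (rule exI[of _ 0], rule allI)
    fix x :: 'k
    obtain r where "x = of_real r" using True by (auto elim: Reals_cases)
    thus "\<exists>w. x = of_real (Re w) + of_real (Im w) * 0 \<and> cmod w \<le> 2 * norm x"
      by (intro exI[of _ "of_real r"]) auto
  qed
next
  case False
  then obtain z :: 'k where z: "z \<notin> \<real>" by auto
  \<comment> \<open>Completing the square in the quadratic relation: after a real shift every
    element is a square root of a nonpositive real.\<close>
  have sq: "\<exists>p v. (x - of_real p)\<^sup>2 = - of_real (v\<^sup>2)" for x :: 'k
  proof -
    obtain w where "poly (map_poly of_real (conj_quad w)) x = 0" 
      using real_normed_field_quadratic by blast
    hence "(x - of_real (Re w))\<^sup>2 = - of_real ((Im w)\<^sup>2)"
      unfolding poly_conj_quad cmod_power2 by (simp add: algebra_simps power2_eq_square eq_neg_iff_add_eq_0)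
    thus ?thesis by blast
  qed
  obtain p v where pv: "(z - of_real p)\<^sup>2 = - of_real (v\<^sup>2)" using sq by blast
  have v0: "v \<noteq> 0"
  proof
    assume "v = 0"
    hence "z = of_real p" using pv by simp
    thus False using z by simp
  qed
  define e where "e = (z - of_real p) / of_real v"
  have e2: "e\<^sup>2 = -1" using v0 by (simp add: e_def power_divide pv)
  have "(norm e)\<^sup>2 = 1" using e2 by (metis norm_minus_cancel norm_one norm_power)
  hence ne: "norm e = 1" using norm_ge_zero[of e] by (simp add: power2_eq_1_iff)
  show ?thesis
  proof (rule exI[of _ e], rule allI)
    fix x :: 'k
    obtain q u where qu: "(x - of_real q)\<^sup>2 = - of_real (u\<^sup>2)" using sq by blast
    \<comment> \<open>Two elements of a field with equal squares agree up to sign, so a single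
      imaginary unit \<open>e\<close> serves every \<open>x\<close>.\<close>
    have "(x - of_real q)\<^sup>2 = (of_real u * e)\<^sup>2" by (simp add: qu power_mult_distrib e2)
    hence "x - of_real q = of_real u * e \<or> x - of_real q = - (of_real u * e)"
      by (simp add: power2_eq_iff)
    then obtain u' where x: "x = of_real q + of_real u' * e"
      by (metis add_diff_cancel_left' diff_add_cancel add.commute mult_minus_left of_real_minus)
    define w where "w = Complex q u'"
    \<comment> \<open>The second factor is the conjugate of \<open>x\<close>. Its norm is bounded
      only by the triangle inequality, since the norm of the field is not yet known to be the
      modulus; this is the origin of the factor 2.\<close>
    have "of_real ((cmod w)\<^sup>2) = x * (of_real q - of_real u' * e)"
    proof -
      have "x * (of_real q - of_real u' * e) = (of_real q)\<^sup>2 - (of_real u')\<^sup>2 * e\<^sup>2"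
        unfolding x by (simp add: algebra_simps power2_eq_square)
      thus ?thesis unfolding cmod_power2 by (simp add: e2 w_def)
    qed
    hence "norm (of_real ((cmod w)\<^sup>2) :: 'k) = norm x * norm (of_real q - of_real u' * e)"
      by (simp add: norm_mult)
    also have "\<dots> \<le> norm x * (\<bar>q\<bar> + \<bar>u'\<bar>)"
      using norm_triangle_ineq4[of "of_real q" "of_real u' * e"] 
      by (intro mult_left_mono) (auto simp: norm_mult ne)
    also have "\<dots> \<le> norm x * (2 * cmod w)"
      using abs_Re_le_cmod[of w] abs_Im_le_cmod[of w] by (intro mult_left_mono) (auto simp: w_def)
    finally have "cmod w * cmod w \<le> (2 * norm x) * cmod w" unfolding norm_of_real by (simp add: power2_eq_square)
    hence "cmod w \<le> 2 * norm x"
      by (cases "cmod w = 0") (auto simp: mult_le_cancel_right simp del: norm_eq_zero)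
    thus "\<exists>w. x = of_real (Re w) + of_real (Im w) * e \<and> cmod w \<le> 2 * norm x"
      using x by (intro exI[of _ w]) (auto simp: w_def)
  qed
qed

section \<open>Norms on finite-dimensional spaces\<close>

text \<open>The coordinates make K^n a continuous image of C^n, and the bound on them puts
  \<open>S\<close> inside the image of a compact ball, in which it is closed.\<close>

lemma compact_vec_field:
  fixes S :: "('k::real_normed_field ^ 'n) set"
  assumes "closed S" "bounded S"
  shows "compact S"
proof -
  obtain e :: 'k where e: "\<And>x. \<exists>w. x = of_real (Re w) + of_real (Im w) * e \<and> cmod w \<le> 2 * norm x"
    using real_normed_field_coordinates by blast
  define h :: "complex ^ 'n \<Rightarrow> 'k ^ 'n"
    where "h = (\<lambda>v. \<chi> i. of_real (Re (v $ i)) + of_real (Im (v $ i)) * e)"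
  obtain B where B: "\<And>x. x \<in> S \<Longrightarrow> norm x \<le> B" using assms(2) by (auto simp: bounded_iff)
  define R where "R = (\<Sum>i\<in>(UNIV :: 'n set). 2 * B)"
  have "S \<subseteq> h ` cball 0 R"
  proof
    fix x assume x: "x \<in> S"
    obtain f where f: "\<And>i. x $ i = of_real (Re (f i)) + of_real (Im (f i)) * e \<and> cmod (f i) \<le> 2 * norm (x $ i)"
      using choice[of "\<lambda>i w. x $ i = of_real (Re w) + of_real (Im w) * e \<and> cmod w \<le> 2 * norm (x $ i)"] e
      by blast
    have "norm (\<chi> i. f i) \<le> (\<Sum>i\<in>UNIV. norm (f i))"
      unfolding norm_vec_def by (simp add: L2_set_le_sum)
    also have "\<dots> \<le> R" unfolding R_def
    proof (rule sum_mono)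
      fix i
      have "norm (x $ i) \<le> norm x" by (rule Finite_Cartesian_Product.norm_nth_le)
      thus "norm (f i) \<le> 2 * B" using f[of i] B[OF x] by linarith
    qed
    finally have "(\<chi> i. f i) \<in> cball 0 R" by simp
    moreover have "x = h (\<chi> i. f i)" using f by (simp add: h_def vec_eq_iff)
    ultimately show "x \<in> h ` cball 0 R" by blast
  qed
  moreover have "continuous_on (cball 0 R) h"
    unfolding h_def by (intro continuous_intros)
  hence "compact (h ` cball 0 R)" by (intro compact_continuous_image compact_cball)
  ultimately show ?thesis using assms(1) by (metis compact_Int_closed inf.absorb2)
qed

section \<open>The bilinear pairing\<close>

lemma pair_commute: "pair x y = pair y x"
  by (simp add: pair_def mult.commute)

lemma pair_simps:
  "pair (x + y) z = pair x z + pair y z" "pair (x - y) z = pair x z - pair y z"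
  "pair (c *s x) z = c * pair x z" "pair 0 z = 0"
  "pair z (x + y) = pair z x + pair z y" "pair z (x - y) = pair z x - pair z y"
  "pair z (c *s x) = c * pair z x" "pair z 0 = 0"
  by (simp_all add: pair_def algebra_simps sum.distrib sum_subtractf sum_distrib_left)

lemma continuous_on_pair [continuous_intros]:
  "continuous_on A f \<Longrightarrow> continuous_on A g \<Longrightarrow> continuous_on A (\<lambda>x. pair (f x) (g x))"
  unfolding pair_def by (intro continuous_intros)

lemma pair_eq_0_imp:
  assumes "\<And>x. pair x \<psi> = 0" shows "\<psi> = 0"
proof -
  have "\<psi> $ i = 0" for i
    using assms[of "axis i 1"] by (simp add: pair_def axis_def if_distrib[of "\<lambda>x. x * _"] cong: if_cong)
  thus ?thesis by (simp add: vec_eq_iff)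
qed

section \<open>Equivalence of norms and the dual norm\<close>

context
  fixes N :: "'k::real_normed_field ^ 'n \<Rightarrow> real"
  assumes N: "is_norm N"
begin

lemma is_norm_nonneg: "0 \<le> N x"
  and is_norm_eq_0: "N x = 0 \<longleftrightarrow> x = 0"
  and is_norm_scale: "N (c *s x) = norm c * N x"
  and is_norm_add: "N (x + y) \<le> N x + N y"
  using N by (auto simp: is_norm_def)

lemma is_norm_uminus: "N (- x) = N x"
  by (subst vector_sneg_minus1) (simp only: is_norm_scale norm_minus_cancel norm_one mult_1)

lemma is_norm_diff: "\<bar>N x - N y\<bar> \<le> N (x - y)"
  using is_norm_add[of y "x - y"] is_norm_add[of x "y - x"] is_norm_uminus[of "x - y"] by simp

lemma is_norm_normalise:
  assumes "x \<noteq> 0"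
  obtains u where "N u = 1" "x = of_real (N x) *s u" 
proof
  have "N x \<noteq> 0" using assms is_norm_eq_0 by simp
  thus "N (of_real (1 / N x) *s x) = 1" "x = of_real (N x) *s (of_real (1 / N x) *s x)"
    using is_norm_nonneg[of x] by (simp_all add: is_norm_scale norm_divide vector_smult_assoc)
qed

lemma norm_le_euclidean: obtains C where "C > 0" "\<And>x. N x \<le> C * norm x"
proof
  define C where "C = (\<Sum>i\<in>UNIV. N (axis i 1)) + 1"
  have C0: "(\<Sum>i\<in>UNIV. N (axis i 1)) \<ge> 0" by (intro sum_nonneg is_norm_nonneg)
  show "C > 0" using C0 by (simp add: C_def)
  have sub: "N (sum f A) \<le> (\<Sum>i\<in>A. N (f i))" if "finite A" for f :: "'n \<Rightarrow> 'k ^ 'n" and A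
    using that
  proof (induction A)
    case (insert a A)
    thus ?case using is_norm_add[of "f a" "sum f A"] by simp
  qed (simp add: is_norm_eq_0[THEN iffD2])
  fix x :: "'k ^ 'n"
  have "x = (\<Sum>i\<in>UNIV. x $ i *s axis i 1)"
    by (simp add: vec_eq_iff axis_def if_distrib[of "\<lambda>a. _ * a"] cong: if_cong)
  hence "N x = N (\<Sum>i\<in>UNIV. x $ i *s axis i 1)" by (rule arg_cong)
  also have "\<dots> \<le> (\<Sum>i\<in>UNIV. N (x $ i *s axis i 1))" by (rule sub) simp
  also have "\<dots> \<le> (\<Sum>i\<in>UNIV. norm x * N (axis i 1))"
    by (intro sum_mono) (auto simp: is_norm_scale intro!: mult_right_mono Finite_Cartesian_Product.norm_nth_le is_norm_nonneg)
  also have "\<dots> \<le> C * norm x" by (simp add: C_def algebra_simps sum_distrib_left)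
  finally show "N x \<le> C * norm x" .
qed

lemma continuous_on_norm: "continuous_on A N"
proof -
  obtain C where C: "C > 0" "\<And>x. N x \<le> C * norm x" by (rule norm_le_euclidean) blast
  have "C-lipschitz_on A N"
  proof (rule lipschitz_onI)
    fix x y
    show "dist (N x) (N y) \<le> C * dist x y"
      using is_norm_diff[of x y] C(2)[of "x - y"] by (simp add: dist_norm)
  qed (use C in simp)
  thus ?thesis by (rule lipschitz_on_continuous_on)
qed

text \<open>The minimum of \<open>N\<close> on the compact Euclidean sphere is positive, and its
  reciprocal is the constant. The estimate makes the unit sphere of \<open>N\<close> bounded and
  hence compact.\<close>

lemma euclidean_le_norm: obtains C where "C > 0" "\<And>x. norm x \<le> C * N x"
proof -
  let ?S = "{x :: 'k ^ 'n. norm x = 1}"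
  have "(1 / norm a) *\<^sub>R a \<in> ?S" if "a = axis undefined 1" for a :: "'k ^ 'n" 
    using that by simp
  hence ne: "?S \<noteq> {}" by blast
  have "compact ?S" by (intro compact_vec_field closed_Collect_eq continuous_intros) (auto simp: bounded_iff)
  from continuous_attains_inf[OF this ne continuous_on_norm]
  obtain v where v: "norm v = 1" "\<And>x. norm x = 1 \<Longrightarrow> N v \<le> N x" by auto
  have "v \<noteq> 0" using v(1) by auto
  hence pos: "N v > 0" using is_norm_nonneg[of v] is_norm_eq_0[of v] by simp
  have "norm x \<le> (1 / N v) * N x" for x
  proof (cases "x = 0")
    case False
    have "(of_real (1 / norm x) :: 'k) *s x = (1 / norm x) *\<^sub>R x" 
      unfolding vec_eq_iff vector_scaleR_component vector_smult_component by (simp add: scaleR_conv_of_real)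
    moreover have "(1 / norm x) *\<^sub>R x \<in> ?S" using False by simp
    ultimately have "N v \<le> N ((of_real (1 / norm x) :: 'k) *s x)" using v(2) by simp
    thus ?thesis using False pos by (simp add: is_norm_scale norm_divide field_simps)
  qed (simp add: is_norm_nonneg)
  thus ?thesis using pos that[of "1 / N v"] by simp
qed

lemma compact_unit_sphere: "compact (unit_sphere N)"
proof (rule compact_vec_field)
  show "closed (unit_sphere N)"
    unfolding unit_sphere_def by (intro closed_Collect_eq continuous_on_norm continuous_on_const)
  obtain C where C: "C > 0" "\<And>x. norm x \<le> C * N x" by (rule euclidean_le_norm) blast
  show "bounded (unit_sphere N)"
    unfolding bounded_iff unit_sphere_def using C(2) by (metis mem_Collect_eq mult.right_neutral)
qed

lemma unit_sphere_nonempty: "unit_sphere N \<noteq> {}"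
proof -
  have "(axis undefined 1 :: 'k ^ 'n) \<noteq> 0" by (simp add: axis_eq_0_iff)
  then obtain u where "N u = 1" by (rule is_norm_normalise)
  thus ?thesis by (auto simp: unit_sphere_def)
qed

lemma bdd_above_sphere:
  assumes "continuous_on UNIV f"
  shows "bdd_above ((f :: _ \<Rightarrow> real) ` unit_sphere N)"
  using compact_continuous_image[OF continuous_on_subset[OF assms] compact_unit_sphere]
  by (simp add: compact_imp_bounded bounded_imp_bdd_above)

lemma norm_pair_le: "norm (pair x \<psi>) \<le> N x * dualnorm N \<psi>"
proof (cases "x = 0")
  case False
  then obtain u where u: "N u = 1" "x = of_real (N x) *s u" by (rule is_norm_normalise)
  have "norm (pair u \<psi>) \<le> dualnorm N \<psi>" unfolding dualnorm_def using u(1)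
    by (intro cSUP_upper bdd_above_sphere continuous_intros) (auto simp: unit_sphere_def)
  hence "N x * norm (pair u \<psi>) \<le> N x * dualnorm N \<psi>" using is_norm_nonneg by (intro mult_left_mono)
  moreover have "norm (pair x \<psi>) = N x * norm (pair u \<psi>)"
    by (subst u(2)) (simp add: pair_simps norm_mult is_norm_nonneg)
  ultimately show ?thesis by simp
qed (simp add: pair_simps is_norm_eq_0[THEN iffD2])

lemma dualnorm_le: "(\<And>x. N x = 1 \<Longrightarrow> norm (pair x \<psi>) \<le> c) \<Longrightarrow> dualnorm N \<psi> \<le> c"
  unfolding dualnorm_def using unit_sphere_nonempty by (intro cSUP_least) (auto simp: unit_sphere_def)

lemma is_norm_dualnorm: "is_norm (dualnorm N)"
proof -
  obtain u where u: "N u = 1" using unit_sphere_nonempty by (auto simp: unit_sphere_def)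
  have nonneg: "0 \<le> dualnorm N \<psi>" for \<psi>
    using norm_pair_le[of u \<psi>] u norm_ge_zero[of "pair u \<psi>"] by (simp del: norm_ge_zero)
  have le: "dualnorm N (c *s \<psi>) \<le> norm c * dualnorm N \<psi>" for c \<psi>
  proof (rule dualnorm_le)
    fix x assume "N x = 1"
    thus "norm (pair x (c *s \<psi>)) \<le> norm c * dualnorm N \<psi>"
      using norm_pair_le[of x \<psi>] by (simp add: pair_simps norm_mult mult_left_mono)
  qed
  \<comment> \<open>The inequality for all scalars already yields equality: for \<open>c\<close>
    nonzero, apply it to the inverse of \<open>c\<close>.\<close>
  have scale: "dualnorm N (c *s \<psi>) = norm c * dualnorm N \<psi>" for c \<psi>
  proof (cases "c = 0")
    case True
    thus ?thesis using le[of c \<psi>] nonneg[of "c *s \<psi>"] by simp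
  next
    case False
    have "dualnorm N \<psi> \<le> norm (inverse c) * dualnorm N (c *s \<psi>)"
      using le[of "inverse c" "c *s \<psi>"] False by (simp add: vector_smult_assoc)
    hence "norm c * dualnorm N \<psi> \<le> dualnorm N (c *s \<psi>)" 
      using False by (simp add: norm_inverse norm_divide field_simps)
    thus ?thesis using le[of c \<psi>] by simp
  qed
  have "dualnorm N \<psi> = 0 \<longleftrightarrow> \<psi> = 0" for \<psi>
  proof
    assume "dualnorm N \<psi> = 0"
    hence "pair x \<psi> = 0" for x using norm_pair_le[of x \<psi>] by simp
    thus "\<psi> = 0" by (rule pair_eq_0_imp)
  next
    assume "\<psi> = 0"
    thus "dualnorm N \<psi> = 0" using scale[of 0 \<psi>] by simp
  qed
  moreover have "dualnorm N (\<psi> + \<phi>) \<le> dualnorm N \<psi> + dualnorm N \<phi>" for \<psi> \<phi>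
  proof (rule dualnorm_le)
    fix x assume "N x = 1"
    thus "norm (pair x (\<psi> + \<phi>)) \<le> dualnorm N \<psi> + dualnorm N \<phi>"
      using norm_pair_le[of x \<psi>] norm_pair_le[of x \<phi>] norm_triangle_ineq[of "pair x \<psi>" "pair x \<phi>"]
      by (simp add: pair_simps)
  qed
  ultimately show ?thesis unfolding is_norm_def using nonneg scale by blast
qed

end

text \<open>The easy half of the canonical isometry into the bidual; it needs no Hahn-Banach
  extension.\<close>

lemma bidual_le:
  assumes "is_norm N" shows "dualnorm (dualnorm N) x \<le> N x"
proof (rule dualnorm_le[OF is_norm_dualnorm[OF assms]])
  fix \<psi> assume "dualnorm N \<psi> = 1"
  thus "norm (pair \<psi> x) \<le> N x" using norm_pair_le[OF assms, of x \<psi>] by (simp add: pair_commute)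
qed

section \<open>Logarithmic potentials\<close>

text \<open>This is min(- log t, m). Placing the truncation inside the logarithm gives the right
  value \<open>m\<close> at \<open>t = 0\<close> without a case distinction.\<close>

definition cut :: "real \<Rightarrow> real \<Rightarrow> real" where
  "cut m t = - ln (max t (exp (- m)))"

lemma cut_nonneg: "t \<le> 1 \<Longrightarrow> 0 \<le> m \<Longrightarrow> 0 \<le> cut m t"
  using ln_mono[of 1 "max t (exp (- m))"] by (simp add: cut_def less_max_iff_disj)

lemma cut_le: "cut m t \<le> m"
proof -
  have "ln (exp (- m)) \<le> ln (max t (exp (- m)))" by (rule ln_mono) (auto simp: less_max_iff_disj)
  thus ?thesis by (simp add: cut_def)
qed

lemma le_exp_cut: "t \<le> exp (- cut m t)"
  by (simp add: cut_def less_max_iff_disj)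

lemma cut_le_neg_ln: "0 < t \<Longrightarrow> cut m t \<le> - ln t"
  unfolding cut_def by (simp add: ln_mono)

text \<open>The clamped arguments stay above \<open>exp (- m)\<close>, where the logarithm has slope
  at most \<open>exp m\<close>.\<close>

lemma cut_lipschitz: "\<bar>cut m s - cut m t\<bar> \<le> exp m * \<bar>s - t\<bar>"
proof -
  define a b where "a = max s (exp (- m))" and "b = max t (exp (- m))"
  have ab: "exp (- m) \<le> a" "exp (- m) \<le> b" "\<bar>a - b\<bar> \<le> \<bar>s - t\<bar>"
    by (auto simp: a_def b_def max_def)
  have *: "ln x - ln y \<le> exp m * \<bar>x - y\<bar>" if xy: "exp (- m) \<le> x" "exp (- m) \<le> y" for x y
  proof -
    have pos: "0 < x" "0 < y" using xy exp_gt_zero[of "- m"] by linarith+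
    have "ln x - ln y = ln (x / y)" using pos by (simp add: ln_div)
    also have "\<dots> \<le> x / y - 1" using pos by (intro ln_le_minus_one) simp
    also have "\<dots> = (x - y) * (1 / y)" using pos by (simp add: field_simps)
    also have "\<dots> \<le> \<bar>x - y\<bar> * exp m"
    proof (rule mult_mono)
      have "1 \<le> exp m * y" 
        using mult_left_mono[OF xy(2), of "exp m"] by (simp add: exp_minus)
      thus "1 / y \<le> exp m" using pos by (simp add: field_simps)
    qed (use pos in auto)
    finally show ?thesis by (simp add: mult.commute)
  qed
  have "\<bar>cut m s - cut m t\<bar> = \<bar>ln a - ln b\<bar>" by (simp add: cut_def a_def b_def)
  also have "\<dots> \<le> exp m * \<bar>a - b\<bar>" using *[of a b] *[of b a] ab by (simp add: abs_minus_commute abs_le_iff)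
  also have "\<dots> \<le> exp m * \<bar>s - t\<bar>" using ab by (intro mult_left_mono) auto
  finally show ?thesis .
qed

text \<open>Scaling by \<open>r\<close> shifts the negative logarithm by \<open>- ln r\<close>,
  which is at most \<open>M\<close>; a truncation level raised by \<open>M\<close> leaves room for
  the shift. Used to pass from unit functionals to their multiples.\<close>

lemma cut_scale:
  assumes "0 \<le> t" "exp (- M) \<le> r"
  shows "cut m t - ln r \<le> cut (m + M) (r * t)"
proof -
  have r: "r > 0" using assms(2) exp_gt_zero[of "- M"] by linarith
  have "exp (- (m + M)) \<le> r * exp (- m)"
    using mult_right_mono[OF assms(2), of "exp (- m)"] by (simp add: exp_add[symmetric] algebra_simps)
  also have "\<dots> \<le> r * max t (exp (- m))" using r by (intro mult_left_mono) auto
  finally have "max (r * t) (exp (- (m + M))) \<le> r * max t (exp (- m))"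
    using r by (intro max.boundedI mult_left_mono) auto
  moreover have "0 < max (r * t) (exp (- (m + M)))" by (simp only: less_max_iff_disj exp_gt_zero simp_thms)
  ultimately have "ln (max (r * t) (exp (- (m + M)))) \<le> ln (r * max t (exp (- m)))"
    by (intro ln_mono) linarith+
  also have "\<dots> = ln r + ln (max t (exp (- m)))" using r by (intro ln_mult_pos) (auto simp: less_max_iff_disj)
  finally show ?thesis by (simp add: cut_def)
qed

lemma min_neglog: "0 \<le> t \<Longrightarrow> t \<le> 1 \<Longrightarrow> min (neglog t) (of_nat m) = ennreal (cut (real m) t)"
proof (cases "t = 0")
  case True
  thus ?thesis by (simp add: neglog_def cut_def ennreal_of_nat_eq_real_of_nat)
next
  case False
  assume "0 \<le> t" "t \<le> 1"
  hence t: "0 < t" "t \<le> 1" using False by auto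
  have "cut (real m) t = min (- ln t) (real m)"
  proof (cases "t \<le> exp (- real m)")
    case True
    moreover have "ln t \<le> - real m" using True t by (metis ln_exp ln_mono)
    ultimately show ?thesis by (simp add: cut_def max_absorb2)
  next
    case False
    moreover have "- real m \<le> ln t" using False t by (simp add: ln_ge_iff)
    ultimately show ?thesis by (simp add: cut_def)
  qed
  thus ?thesis using False t by (simp add: neglog_def ennreal_of_nat_eq_real_of_nat min_def ennreal_le_iff2)
qed

lemma measurable_neglog [measurable]: "neglog \<in> borel_measurable borel"
  unfolding neglog_def by measurable

lemma measurable_cut [measurable]: "cut m \<in> borel_measurable borel"
  unfolding cut_def by measurable

text \<open>Allowing dual norms in \<open>[r, 1]\<close> instead of unit vectors makes these facts applicable to
  the unit sphere of \<open>N\<close> when \<open>\<eta>\<close> is admissible for \<open>dualnorm N\<close>, without knowing that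
  the bidual norm is \<open>N\<close>.\<close>

context
  fixes NY :: "'k::real_normed_field ^ 'n \<Rightarrow> real" and K S :: "('k ^ 'n) set" and lam r
  assumes NY: "is_norm NY" and prob: "prob_space lam" and adm: "admissible NY K lam"
    and r: "0 < r" and S: "\<forall>\<phi>\<in>S. r \<le> dualnorm NY \<phi> \<and> dualnorm NY \<phi> \<le> 1"
begin

interpretation prob_space lam by (rule prob)

lemma space_admissible: "space lam = K"
proof -
  have "space lam = space (restrict_space borel K)"
    using adm unfolding admissible_def by (intro sets_eq_imp_space_eq) blast
  thus ?thesis by (simp add: space_restrict_space)
qed

lemma measurable_admissible:
  assumes "f \<in> borel_measurable borel" shows "f \<in> borel_measurable lam"
proof -
  have "sets lam = sets (restrict_space borel K)" using adm unfolding admissible_def by blast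
  thus ?thesis using measurable_restrict_space1[OF assms] measurable_cong_sets by blast
qed

lemma measurable_norm_pair [measurable]: "(\<lambda>y. norm (pair y \<phi>)) \<in> borel_measurable lam"
  by (intro measurable_admissible borel_measurable_continuous_onI continuous_intros)

lemma norm_admissible: "y \<in> space lam \<Longrightarrow> NY y \<le> 1"
  using adm by (auto simp: space_admissible admissible_def unit_ball_def)

lemma norm_pair_le_1:
  assumes "y \<in> space lam" "dualnorm NY \<phi> \<le> 1" shows "norm (pair y \<phi>) \<le> 1"
  using norm_pair_le[OF NY, of y \<phi>] mult_le_one[OF norm_admissible is_norm_nonneg[OF is_norm_dualnorm[OF NY]] assms(2)]
    assms by fastforce

lemma integrable_cut: 
  assumes "dualnorm NY \<phi> \<le> 1" "0 \<le> m"
  shows "integrable lam (\<lambda>y. cut m (norm (pair y \<phi>)))"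
proof (rule integrable_const_bound[of _ m])
  show "AE y in lam. norm (cut m (norm (pair y \<phi>))) \<le> m"
    using cut_nonneg[OF norm_pair_le_1[OF _ assms(1)] assms(2)] cut_le by (intro AE_I2) auto
qed measurable

text \<open>Since \<open>neglog\<close> is infinite at 0, finiteness of its integral makes the zero
  set of the functional null. The conventional real value of \<open>ln 0\<close> therefore never
  counts, and the Bochner integral is the genuine logarithmic potential.\<close>

lemma unit_functional:
  assumes "dualnorm NY u = 1"
  shows "AE y in lam. pair y u \<noteq> 0" "integrable lam (\<lambda>y. ln (norm (pair y u)))"
    "enn2real (\<integral>\<^sup>+ y. neglog (norm (pair y u)) \<partial>lam) = - (\<integral>y. ln (norm (pair y u)) \<partial>lam)"
proof -
  have fin: "(\<integral>\<^sup>+ y. neglog (norm (pair y u)) \<partial>lam) < \<infinity>"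
    using adm assms by (auto simp: admissible_def unit_sphere_def)
  have "AE y in lam. neglog (norm (pair y u)) \<noteq> \<infinity>"
    by (rule nn_integral_PInf_AE) (use fin in auto)
  thus AE: "AE y in lam. pair y u \<noteq> 0" by eventually_elim (auto simp: neglog_def)
  have "AE y in lam. neglog (norm (pair y u)) = ennreal (- ln (norm (pair y u)))"
    using AE by eventually_elim (auto simp: neglog_def)
  hence eq: "(\<integral>\<^sup>+ y. neglog (norm (pair y u)) \<partial>lam) = (\<integral>\<^sup>+ y. ennreal (- ln (norm (pair y u))) \<partial>lam)"
    by (rule nn_integral_cong_AE)
  have nonneg: "AE y in lam. 0 \<le> - ln (norm (pair y u))"
    using AE AE_space by eventually_elim (use norm_pair_le_1[of _ u] assms in auto)
  have "integrable lam (\<lambda>y. - ln (norm (pair y u)))"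
    by (rule integrableI_nonneg) (use fin eq nonneg in auto)
  thus "integrable lam (\<lambda>y. ln (norm (pair y u)))" by simp
  have "(\<integral>y. - ln (norm (pair y u)) \<partial>lam) = enn2real (\<integral>\<^sup>+ y. ennreal (- ln (norm (pair y u))) \<partial>lam)"
    by (rule integral_eq_nn_integral) (use nonneg in auto)
  thus "enn2real (\<integral>\<^sup>+ y. neglog (norm (pair y u)) \<partial>lam) = - (\<integral>y. ln (norm (pair y u)) \<partial>lam)"
    by (simp add: eq)
qed

lemma unit_functional_approx:
  assumes "\<epsilon> > 0"
  shows "\<exists>m\<ge>0. \<forall>u. dualnorm NY u = 1 \<longrightarrow>
    - (\<integral>y. ln (norm (pair y u)) \<partial>lam) \<le> (\<integral>y. cut m (norm (pair y u)) \<partial>lam) + \<epsilon>"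
proof -
  have "\<forall>\<^sub>F m in sequentially. \<forall>u\<in>unit_sphere (dualnorm NY).
     dist (- enn2real (\<integral>\<^sup>+ y. min (neglog (norm (pair y u))) (of_nat m) \<partial>lam))
       (- enn2real (\<integral>\<^sup>+ y. neglog (norm (pair y u)) \<partial>lam)) < \<epsilon>"
    using adm assms unfolding admissible_def uniform_limit_iff by blast
  then obtain m where m: "\<And>u. dualnorm NY u = 1 \<Longrightarrow>
     dist (- enn2real (\<integral>\<^sup>+ y. min (neglog (norm (pair y u))) (of_nat m) \<partial>lam))
       (- enn2real (\<integral>\<^sup>+ y. neglog (norm (pair y u)) \<partial>lam)) < \<epsilon>"
    unfolding eventually_sequentially unit_sphere_def by auto
  have "- (\<integral>y. ln (norm (pair y u)) \<partial>lam) \<le> (\<integral>y. cut m (norm (pair y u)) \<partial>lam) + \<epsilon>"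
    if u: "dualnorm NY u = 1" for u
  proof -
    have 1: "norm (pair y u) \<le> 1" if "y \<in> space lam" for y using norm_pair_le_1 that u by simp
    have "(\<integral>\<^sup>+ y. min (neglog (norm (pair y u))) (of_nat m) \<partial>lam) 
        = (\<integral>\<^sup>+ y. ennreal (cut (real m) (norm (pair y u))) \<partial>lam)"
      by (intro nn_integral_cong min_neglog 1) auto
    also have "enn2real \<dots> = (\<integral>y. cut (real m) (norm (pair y u)) \<partial>lam)"
      using 1 by (intro integral_eq_nn_integral[symmetric] AE_I2 cut_nonneg) auto
    finally show ?thesis using m[OF u] unit_functional(3)[OF u] by (simp add: dist_real_def)
  qed
  thus ?thesis by (intro exI[of _ "real m"]) auto
qed

lemma functional_normalise:
  assumes "\<phi> \<in> S"
  obtains u where "dualnorm NY u = 1" "\<And>y. norm (pair y \<phi>) = dualnorm NY \<phi> * norm (pair y u)"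
proof -
  note D = is_norm_dualnorm[OF NY]
  have "\<phi> \<noteq> 0" using S[rule_format, OF assms] r is_norm_eq_0[OF D, of \<phi>] by auto
  then obtain u where u: "dualnorm NY u = 1" "\<phi> = of_real (dualnorm NY \<phi>) *s u" 
    by (rule is_norm_normalise[OF D])
  have "norm (pair y \<phi>) = dualnorm NY \<phi> * norm (pair y u)" for y
    by (subst u(2)) (simp add: pair_simps norm_mult is_norm_nonneg[OF D])
  thus ?thesis using u that by blast
qed

lemma AE_pair_neq_0:
  assumes "\<phi> \<in> S" shows "AE y in lam. pair y \<phi> \<noteq> 0"
proof -
  obtain u where u: "dualnorm NY u = 1" "\<And>y. norm (pair y \<phi>) = dualnorm NY \<phi> * norm (pair y u)"
    using functional_normalise[OF assms] by blast
  have "dualnorm NY \<phi> > 0" using S[rule_format, OF assms] r by linarith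
  hence "pair y \<phi> \<noteq> 0" if "pair y u \<noteq> 0" for y using u(2)[of y] that by auto
  thus ?thesis using unit_functional(1)[OF u(1)] by auto
qed

lemma AE_ln_pair:
  assumes "dualnorm NY u = 1" "\<phi> \<in> S" "\<And>y. norm (pair y \<phi>) = dualnorm NY \<phi> * norm (pair y u)"
  shows "AE y in lam. ln (norm (pair y u)) + ln (dualnorm NY \<phi>) = ln (norm (pair y \<phi>))"
proof -
  have "dualnorm NY \<phi> > 0" using S[rule_format, OF assms(2)] r by linarith
  with unit_functional(1)[OF assms(1)] show ?thesis
    by (auto simp: assms(3) ln_mult_pos)
qed

lemma integrable_ln_pair:
  assumes "\<phi> \<in> S" shows "integrable lam (\<lambda>y. ln (norm (pair y \<phi>)))"
proof -
  obtain u where u: "dualnorm NY u = 1" "\<And>y. norm (pair y \<phi>) = dualnorm NY \<phi> * norm (pair y u)"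
    using functional_normalise[OF assms] by blast
  have "integrable lam (\<lambda>y. ln (norm (pair y u)) + ln (dualnorm NY \<phi>))"
    using unit_functional(2)[OF u(1)] by simp
  thus ?thesis
    by (rule integrable_cong_AE_imp) (use AE_ln_pair[OF u(1) assms u(2)] in auto)
qed

lemma integral_cut_le:
  assumes "\<phi> \<in> S" "0 \<le> m"
  shows "(\<integral>y. cut m (norm (pair y \<phi>)) \<partial>lam) \<le> - (\<integral>y. ln (norm (pair y \<phi>)) \<partial>lam)"
proof -
  have "(\<integral>y. cut m (norm (pair y \<phi>)) \<partial>lam) \<le> (\<integral>y. - ln (norm (pair y \<phi>)) \<partial>lam)"
  proof (rule integral_mono_AE)
    show "AE y in lam. cut m (norm (pair y \<phi>)) \<le> - ln (norm (pair y \<phi>))"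
      using AE_pair_neq_0[OF assms(1)] by eventually_elim (simp add: cut_le_neg_ln)
  qed (use S[rule_format, OF assms(1)] assms integrable_ln_pair integrable_cut in auto)
  thus ?thesis by simp
qed

text \<open>Admissibility speaks of unit functionals only. Writing \<phi> as d times a unit
  functional shifts the potential by exactly \<open>ln d\<close>, and \<open>cut_scale\<close>
  recovers this shift for the truncated integral once the level is raised by \<open>M\<close>, which
  dominates \<open>- ln d\<close> because \<open>r \<le> d\<close>.\<close>

lemma uniform_cut_approx:
  assumes "\<epsilon> > 0"
  shows "\<exists>m\<ge>0. \<forall>\<phi>\<in>S.
    - (\<integral>y. ln (norm (pair y \<phi>)) \<partial>lam) \<le> (\<integral>y. cut m (norm (pair y \<phi>)) \<partial>lam) + \<epsilon>"
proof -
  obtain m where m: "m \<ge> 0" "\<And>u. dualnorm NY u = 1 \<Longrightarrow>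
    - (\<integral>y. ln (norm (pair y u)) \<partial>lam) \<le> (\<integral>y. cut m (norm (pair y u)) \<partial>lam) + \<epsilon>"
    using unit_functional_approx[OF assms] by blast
  define M where "M = max 0 (- ln r)"
  have M: "exp (- M) \<le> r" using r by (simp add: M_def max_def)
  have "- (\<integral>y. ln (norm (pair y \<phi>)) \<partial>lam) \<le> (\<integral>y. cut (m + M) (norm (pair y \<phi>)) \<partial>lam) + \<epsilon>"
    if \<phi>: "\<phi> \<in> S" for \<phi>
  proof -
    let ?d = "dualnorm NY \<phi>"
    obtain u where u: "dualnorm NY u = 1" "\<And>y. norm (pair y \<phi>) = ?d * norm (pair y u)"
      using functional_normalise[OF \<phi>] by blast
    have "(\<integral>y. ln (norm (pair y \<phi>)) \<partial>lam) = (\<integral>y. ln (norm (pair y u)) + ln ?d \<partial>lam)"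
      by (rule integral_cong_AE) (use AE_ln_pair[OF u(1) \<phi> u(2)] in \<open>auto simp: eq_commute\<close>)
    also have "\<dots> = (\<integral>y. ln (norm (pair y u)) \<partial>lam) + ln ?d"
      using unit_functional(2)[OF u(1)] by (simp add: prob_space)
    finally have 1: "(\<integral>y. ln (norm (pair y \<phi>)) \<partial>lam) = (\<integral>y. ln (norm (pair y u)) \<partial>lam) + ln ?d" .
    have "(\<integral>y. cut m (norm (pair y u)) \<partial>lam) - ln ?d = (\<integral>y. cut m (norm (pair y u)) - ln ?d \<partial>lam)"
      using integrable_cut[of u m] u(1) m(1) by (simp add: prob_space)
    also have "\<dots> \<le> (\<integral>y. cut (m + M) (norm (pair y \<phi>)) \<partial>lam)"
    proof (rule integral_mono)
      show "integrable lam (\<lambda>y. cut m (norm (pair y u)) - ln ?d)"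
        using integrable_cut[of u m] u(1) m(1) by simp
      show "integrable lam (\<lambda>y. cut (m + M) (norm (pair y \<phi>)))"
        using S[rule_format, OF \<phi>] m(1) by (intro integrable_cut) (auto simp: M_def)
      fix y
      show "cut m (norm (pair y u)) - ln ?d \<le> cut (m + M) (norm (pair y \<phi>))"
        unfolding u(2) using S[rule_format, OF \<phi>] M by (intro cut_scale) auto
    qed
    finally show ?thesis using 1 m(2)[OF u(1)] by linarith
  qed
  moreover have "0 \<le> m + M" using m(1) by (simp add: M_def)
  ultimately show ?thesis by blast
qed

lemma integral_cut_lipschitz:
  assumes "\<phi> \<in> S" "\<phi>' \<in> S" "0 \<le> m"
  shows "(\<integral>y. cut m (norm (pair y \<phi>)) \<partial>lam)
    \<le> (\<integral>y. cut m (norm (pair y \<phi>')) \<partial>lam) + exp m * dualnorm NY (\<phi> - \<phi>')"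
proof -
  let ?d = "dualnorm NY (\<phi> - \<phi>')"
  have d: "?d \<ge> 0" by (rule is_norm_nonneg[OF is_norm_dualnorm[OF NY]])
  have int: "integrable lam (\<lambda>y. cut m (norm (pair y \<psi>)))" if "\<psi> \<in> S" for \<psi>
    using S[rule_format, OF that] assms(3) by (intro integrable_cut) auto
  have "(\<integral>y. cut m (norm (pair y \<phi>)) \<partial>lam) \<le> (\<integral>y. cut m (norm (pair y \<phi>')) + exp m * ?d \<partial>lam)"
  proof (rule integral_mono)
    fix y assume y: "y \<in> space lam"
    have "\<bar>norm (pair y \<phi>) - norm (pair y \<phi>')\<bar> \<le> norm (pair y (\<phi> - \<phi>'))"
      unfolding pair_simps by (rule norm_triangle_ineq3)
    also have "\<dots> \<le> NY y * ?d" by (rule norm_pair_le[OF NY])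
    also have "\<dots> \<le> 1 * ?d" using norm_admissible[OF y] d by (intro mult_right_mono)
    finally have "exp m * \<bar>norm (pair y \<phi>) - norm (pair y \<phi>')\<bar> \<le> exp m * ?d"
      by (intro mult_left_mono) auto
    thus "cut m (norm (pair y \<phi>)) \<le> cut m (norm (pair y \<phi>')) + exp m * ?d"
      using cut_lipschitz[of m "norm (pair y \<phi>)" "norm (pair y \<phi>')"] by linarith
  qed (use int assms in auto)
  also have "\<dots> = (\<integral>y. cut m (norm (pair y \<phi>')) \<partial>lam) + exp m * ?d"
    using int[OF assms(2)] by (simp add: prob_space)
  finally show ?thesis .
qed

text \<open>The truncated integral lies below the negative potential and, at a suitable level,
  within \<epsilon>/2 of it on all of \<open>S\<close>; being Lipschitz, it moves by less than
  another \<epsilon>/2 between close points. A one-sided estimate suffices, as the two points may be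
  exchanged.\<close>

lemma continuous_on_integral_ln: "continuous_on S (\<lambda>\<phi>. \<integral>y. ln (norm (pair y \<phi>)) \<partial>lam)"
  unfolding continuous_on_iff
proof (intro ballI allI impI)
  fix \<phi> and \<epsilon> :: real assume \<phi>: "\<phi> \<in> S" and \<epsilon>: "\<epsilon> > 0"
  let ?G = "\<lambda>\<phi>. \<integral>y. ln (norm (pair y \<phi>)) \<partial>lam"
  obtain m where m: "m \<ge> 0" "\<And>\<phi>. \<phi> \<in> S \<Longrightarrow> - ?G \<phi> \<le> (\<integral>y. cut m (norm (pair y \<phi>)) \<partial>lam) + \<epsilon> / 2"
    using uniform_cut_approx[of "\<epsilon> / 2"] \<epsilon> by auto
  obtain C where C: "C > 0" "\<And>x. dualnorm NY x \<le> C * norm x"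
    by (rule norm_le_euclidean[OF is_norm_dualnorm[OF NY]]) blast
  define d where "d = \<epsilon> / (2 * exp m * C)"
  have "dist (?G \<phi>') (?G \<phi>) < \<epsilon>" if \<phi>': "\<phi>' \<in> S" "dist \<phi>' \<phi> < d" for \<phi>'
  proof -
    have lt: "- ?G \<phi>1 < - ?G \<phi>2 + \<epsilon>" if "\<phi>1 \<in> S" "\<phi>2 \<in> S" "dist \<phi>1 \<phi>2 < d" for \<phi>1 \<phi>2
    proof -
      have "exp m * dualnorm NY (\<phi>1 - \<phi>2) \<le> exp m * (C * dist \<phi>1 \<phi>2)"
        using C(2)[of "\<phi>1 - \<phi>2"] by (simp add: dist_norm)
      also have "\<dots> < exp m * (C * d)" using that(3) C(1) by simp
      also have "\<dots> = \<epsilon> / 2" using C(1) by (simp add: d_def field_simps)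
      finally show ?thesis
        using integral_cut_lipschitz[OF that(1,2) m(1)] m(2)[OF that(1)] integral_cut_le[OF that(2) m(1)]
        by linarith
    qed
    show ?thesis using lt[of \<phi> \<phi>'] lt[of \<phi>' \<phi>] \<phi> \<phi>' by (simp add: dist_real_def dist_commute)
  qed
  moreover have "d > 0" using \<epsilon> C(1) by (simp add: d_def)
  ultimately show "\<exists>d>0. \<forall>\<phi>'\<in>S. dist \<phi>' \<phi> < d \<longrightarrow> dist (?G \<phi>') (?G \<phi>) < \<epsilon>" by blast
qed

end

section \<open>Polarization constants\<close>

lemma fekete_superadditive:
  fixes a :: "nat \<Rightarrow> real"
  assumes add: "\<And>m n. a m + a n \<le> a (m + n)" and nonneg: "\<And>n. 0 \<le> a n"
    and bound: "\<And>n. a n \<le> real n * U"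
  shows "convergent (\<lambda>n. a n / real n)"
proof -
  define L where "L = (SUP n\<in>{1..}. a n / real n)"
  have bdd: "bdd_above ((\<lambda>n. a n / real n) ` {1..})"
    using bound by (intro bdd_aboveI2[of _ _ U]) (simp add: field_simps)
  have upper: "a n / real n \<le> L" if "n \<ge> 1" for n
    unfolding L_def using that by (intro cSUP_upper bdd) auto
  have mult: "real q * a k \<le> a (q * k)" for q k
  proof (induction q)
    case (Suc q)
    thus ?case using add[of k "q * k"] by (simp add: algebra_simps)
  qed (simp add: nonneg)
  have "(\<lambda>n. a n / real n) \<longlonglongrightarrow> L"
  proof (rule order_tendstoI)
    fix x assume "x < L"
    then obtain k where k: "k \<ge> 1" "x < a k / real k"
      using less_cSUP_iff[OF _ bdd, of x] by (auto simp: L_def)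
    \<comment> \<open>The incomplete last block of length below \<open>k\<close> costs at most one
      \<open>a k\<close>, which is negligible after division by \<open>n\<close>.\<close>
    have lower: "a k / real k - a k / real n \<le> a n / real n" if n: "n \<ge> 1" for n
    proof -
      have "real n = real (n div k) * real k + real (n mod k)"
        by (metis div_mult_mod_eq of_nat_add of_nat_mult)
      moreover have "n mod k < k" using k by simp
      ultimately have "real n \<le> (real (n div k) + 1) * real k" by (simp add: algebra_simps)
      hence "real n / real k - 1 \<le> real (n div k)" using k by (simp add: field_simps)
      hence "(real n / real k - 1) * a k \<le> real (n div k) * a k"
        by (intro mult_right_mono nonneg)
      also have "\<dots> \<le> a (n div k * k)" by (rule mult)
      also have "\<dots> \<le> a n" using add[of "n div k * k" "n mod k"] nonneg[of "n mod k"] by simp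
      finally have "(real n / real k - 1) * a k / real n \<le> a n / real n"
        by (rule divide_right_mono) simp
      thus ?thesis using n k by (simp add: diff_divide_distrib left_diff_distrib)
    qed
    have "(\<lambda>n. a k / real k - a k / real n) \<longlonglongrightarrow> a k / real k - 0"
      by (intro tendsto_intros lim_const_over_n)
    hence "\<forall>\<^sub>F n in sequentially. x < a k / real k - a k / real n"
      using k(2) by (intro order_tendstoD(1)) auto
    thus "\<forall>\<^sub>F n in sequentially. x < a n / real n"
      using eventually_ge_at_top[of 1] by eventually_elim (use lower in force)
  next
    fix x assume "L < x"
    show "\<forall>\<^sub>F n in sequentially. a n / real n < x"
      using eventually_ge_at_top[of 1] by eventually_elim (use upper \<open>L < x\<close> in force)
  qed
  thus ?thesis by (rule convergentI)
qed

text \<open>The positive minimum of the bidual norm on the compact sphere serves as the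
  \<open>r\<close> that the facts on potentials ask for when the measure lives on the dual
  sphere.\<close>

lemma bidual_bounds:
  assumes N: "is_norm N"
  obtains r where "0 < r"
    "\<forall>x\<in>unit_sphere N. r \<le> dualnorm (dualnorm N) x \<and> dualnorm (dualnorm N) x \<le> 1"
proof -
  let ?N = "dualnorm (dualnorm N)"
  note DD = is_norm_dualnorm[OF is_norm_dualnorm[OF N]]
  obtain z where z: "z \<in> unit_sphere N" "\<And>x. x \<in> unit_sphere N \<Longrightarrow> ?N z \<le> ?N x"
    using continuous_attains_inf[OF compact_unit_sphere[OF N] unit_sphere_nonempty[OF N] continuous_on_norm[OF DD]]
    by blast
  have "z \<noteq> 0" using z(1) is_norm_eq_0[OF N, of z] by (auto simp: unit_sphere_def)
  hence "0 < ?N z" using is_norm_nonneg[OF DD, of z] is_norm_eq_0[OF DD, of z] by simp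
  moreover have "?N z \<le> ?N x \<and> ?N x \<le> 1" if "x \<in> unit_sphere N" for x
    using z(2)[OF that] bidual_le[OF N, of x] that by (simp add: unit_sphere_def)
  ultimately show ?thesis using that by blast
qed

lemma prod_lessThan_add:
  "(\<Prod>i<n + m::nat. f i) = (\<Prod>i<n. f i) * (\<Prod>i<m. f (n + i) :: 'a::comm_monoid_mult)"
  by (induction m) (simp_all add: mult.assoc)

text \<open>Enumerate the disjoint union of the fibres and project. This turns multiplicities into a
  sequence of functionals of the form that \<open>prod_norm\<close> expects.\<close>

lemma ex_map_with_fibre_cards:
  fixes k :: "'a \<Rightarrow> nat"
  assumes "finite J"
  shows "\<exists>\<sigma>. (\<forall>i<sum k J. \<sigma> i \<in> J) \<and>
    (\<forall>f :: 'a \<Rightarrow> 'b::comm_monoid_mult. (\<Prod>i<sum k J. f (\<sigma> i)) = (\<Prod>j\<in>J. f j ^ k j))"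
proof -
  let ?S = "SIGMA j:J. {..<k j}"
  have "finite ?S" "card ?S = sum k J" using assms by auto
  then obtain b where b: "bij_betw b {..<sum k J} ?S"
    using ex_bij_betw_nat_finite[of ?S] by (auto simp: lessThan_atLeast0)
  show ?thesis
  proof (intro exI[of _ "fst \<circ> b"] conjI allI impI)
    show "(fst \<circ> b) i \<in> J" if "i < sum k J" for i
      using bij_betw_apply[OF b, of i] that by (cases "b i") auto
    fix f :: "'a \<Rightarrow> 'b"
    have "(\<Prod>i<sum k J. f (fst (b i))) = (\<Prod>s\<in>?S. f (fst s))"
      by (rule prod.reindex_bij_betw[OF b])
    also have "\<dots> = (\<Prod>j\<in>J. \<Prod>l<k j. f j)"
      using assms by (subst prod.Sigma) (auto simp: split_beta)
    finally show "(\<Prod>i<sum k J. f ((fst \<circ> b) i)) = (\<Prod>j\<in>J. f j ^ k j)" by simp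
  qed
qed

section \<open>Bounds for products of functionals and the polarization constants\<close>

context
  fixes N :: "'k::real_normed_field ^ 'n \<Rightarrow> real"
  assumes N: "is_norm N"
begin

lemma dual_is_norm: "is_norm (dualnorm N)"
  by (rule is_norm_dualnorm[OF N])

text \<open>Named separately because it must be shown nonempty before its infimum says
  anything.\<close>

definition pol_bounds :: "nat \<Rightarrow> real set" where
  "pol_bounds n = {c. \<forall>\<psi>. (\<Prod>i<n. dualnorm N (\<psi> i)) \<le> c * prod_norm N n \<psi>}"

lemma lin_pol_const_eq: "lin_pol_const N n = Inf (pol_bounds n)"
  by (simp add: lin_pol_const_def pol_bounds_def)

lemma norm_prod_le_prod_norm: "N x = 1 \<Longrightarrow> norm (\<Prod>i<n. pair x (\<psi> i)) \<le> prod_norm N n \<psi>"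
  unfolding prod_norm_def
  by (intro cSUP_upper bdd_above_sphere[OF N] continuous_intros) (simp add: unit_sphere_def)

lemma prod_norm_le:
  "(\<And>x. N x = 1 \<Longrightarrow> norm (\<Prod>i<n. pair x (\<psi> i)) \<le> c) \<Longrightarrow> prod_norm N n \<psi> \<le> c"
  unfolding prod_norm_def using unit_sphere_nonempty[OF N]
  by (intro cSUP_least) (auto simp: unit_sphere_def)

lemma prod_norm_nonneg: "0 \<le> prod_norm N n \<psi>"
proof -
  obtain x where "N x = 1" using unit_sphere_nonempty[OF N] by (auto simp: unit_sphere_def)
  from norm_prod_le_prod_norm[OF this, of \<psi> n] show ?thesis
    using norm_ge_zero order_trans by blast
qed

text \<open>Tested on the n-th power of one unit functional, which has norm at most 1.\<close>

lemma pol_bounds_ge_1: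
  assumes c: "c \<in> pol_bounds n" shows "1 \<le> c"
proof -
  obtain v where v: "dualnorm N v = 1" using unit_sphere_nonempty[OF dual_is_norm] by (auto simp: unit_sphere_def)
  let ?P = "prod_norm N n (\<lambda>_. v)"
  have "?P \<le> 1"
  proof (rule prod_norm_le)
    fix x assume "N x = 1"
    hence "norm (pair x v) \<le> 1" using norm_pair_le[OF N, of x v] v by simp
    thus "norm (\<Prod>i<n. pair x v) \<le> 1" by (simp add: norm_power power_le_one)
  qed
  moreover have "1 \<le> c * ?P" using c v by (auto simp: pol_bounds_def dest!: spec[of _ "\<lambda>_. v"])
  moreover have "0 \<le> ?P" by (rule prod_norm_nonneg)
  ultimately show ?thesis
    by (smt (verit) mult_left_le mult_nonneg_nonneg mult_nonpos_nonneg)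
qed

lemma bdd_below_pol_bounds: "bdd_below (pol_bounds n)"
  using pol_bounds_ge_1 by (intro bdd_belowI[of _ 1])

lemma lin_pol_const_le: "c \<in> pol_bounds n \<Longrightarrow> lin_pol_const N n \<le> c"
  unfolding lin_pol_const_eq by (intro cInf_lower bdd_below_pol_bounds)

text \<open>Both sides are homogeneous in each functional, so unit functionals suffice; if one
  functional vanishes, the left side is zero.\<close>

lemma pol_boundsI:
  assumes c: "0 \<le> c" and unit: "\<And>\<psi>. (\<And>i. i < n \<Longrightarrow> dualnorm N (\<psi> i) = 1) \<Longrightarrow> 1 \<le> c * prod_norm N n \<psi>"
  shows "c \<in> pol_bounds n"
  unfolding pol_bounds_def
proof (intro CollectI allI)
  fix \<psi> :: "nat \<Rightarrow> 'k ^ 'n"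
  let ?d = "\<Prod>i<n. dualnorm N (\<psi> i)"
  show "?d \<le> c * prod_norm N n \<psi>"
  proof (cases "?d = 0")
    case True
    show ?thesis using c by (subst True) (simp add: prod_norm_nonneg)
  next
    case False
    have "0 \<le> ?d" by (intro prod_nonneg) (auto simp: is_norm_nonneg[OF dual_is_norm])
    hence d: "?d > 0" using False by linarith
    have "\<exists>u. dualnorm N u = 1 \<and> \<psi> i = of_real (dualnorm N (\<psi> i)) *s u" if "i < n" for i
    proof -
      have "dualnorm N (\<psi> i) \<noteq> 0" using False that by auto
      hence "\<psi> i \<noteq> 0" using is_norm_eq_0[OF dual_is_norm, of "\<psi> i"] by simp
      then obtain u where "dualnorm N u = 1" "\<psi> i = of_real (dualnorm N (\<psi> i)) *s u" by (rule is_norm_normalise[OF dual_is_norm])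
      thus ?thesis by blast
    qed
    then obtain u where u: "\<And>i. i < n \<Longrightarrow> dualnorm N (u i) = 1" "\<And>i. i < n \<Longrightarrow> \<psi> i = of_real (dualnorm N (\<psi> i)) *s u i"
      by metis
    have "prod_norm N n u \<le> prod_norm N n \<psi> / ?d"
    proof (rule prod_norm_le)
      fix x assume x: "N x = 1"
      have "norm (pair x (\<psi> i)) = dualnorm N (\<psi> i) * norm (pair x (u i))" if "i < n" for i
        by (subst u(2)[OF that]) (simp add: pair_simps norm_mult is_norm_nonneg[OF dual_is_norm])
      hence "norm (\<Prod>i<n. pair x (\<psi> i)) = ?d * norm (\<Prod>i<n. pair x (u i))"
        by (simp add: prod_norm[symmetric] prod.distrib)
      thus "norm (\<Prod>i<n. pair x (u i)) \<le> prod_norm N n \<psi> / ?d"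
        using norm_prod_le_prod_norm[OF x, of \<psi> n] d by (simp add: field_simps)
    qed
    hence "c * prod_norm N n u \<le> c * (prod_norm N n \<psi> / ?d)" using c by (rule mult_left_mono)
    with unit[of u] u(1) have "1 \<le> c * (prod_norm N n \<psi> / ?d)" by force
    thus ?thesis using d by (simp add: field_simps)
  qed
qed

text \<open>Juxtapose n functionals \<psi> and m functionals \<phi>. For fixed \<phi>, dividing the
  inequality by the norms of \<phi> exhibits a bound for n, which is at least c_n; read for varying
  \<phi>, this says that c / c_n is a bound for m. Nonemptiness gives c_n \<ge> 1, which makes the
  division legitimate.\<close>

lemma pol_bounds_add:
  assumes c: "c \<in> pol_bounds (n + m)" and ne: "pol_bounds n \<noteq> {}"
  shows "lin_pol_const N n * lin_pol_const N m \<le> c"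
proof -
  let ?c = "lin_pol_const N n"
  have c1: "1 \<le> ?c" unfolding lin_pol_const_eq using ne pol_bounds_ge_1 by (intro cInf_greatest)
  have c0: "0 \<le> c" using pol_bounds_ge_1[OF c] by simp
  have "(\<Prod>i<m. dualnorm N (\<phi> i)) \<le> c / ?c * prod_norm N m \<phi>" for \<phi>
  proof (cases "(\<Prod>i<m. dualnorm N (\<phi> i)) = 0")
    case True
    show ?thesis using c1 c0 by (subst True) (simp add: prod_norm_nonneg)
  next
    case False
    let ?d = "\<Prod>i<m. dualnorm N (\<phi> i)"
    have "0 \<le> ?d" by (intro prod_nonneg) (auto simp: is_norm_nonneg[OF dual_is_norm])
    hence d: "?d > 0" using False by linarith
    have "c * prod_norm N m \<phi> / ?d \<in> pol_bounds n"
      unfolding pol_bounds_def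
    proof (intro CollectI allI)
      fix \<psi> :: "nat \<Rightarrow> 'k ^ 'n"
      define \<omega> where "\<omega> = (\<lambda>i. if i < n then \<psi> i else \<phi> (i - n))"
      have split: "(\<Prod>i<n + m. f (\<omega> i)) = (\<Prod>i<n. f (\<psi> i)) * (\<Prod>i<m. f (\<phi> i))"
        for f :: "'k ^ 'n \<Rightarrow> 'c::comm_monoid_mult"
        unfolding prod_lessThan_add by (simp add: \<omega>_def)
      have "prod_norm N (n + m) \<omega> \<le> prod_norm N n \<psi> * prod_norm N m \<phi>"
      proof (rule prod_norm_le)
        fix x assume "N x = 1"
        thus "norm (\<Prod>i<n + m. pair x (\<omega> i)) \<le> prod_norm N n \<psi> * prod_norm N m \<phi>"
          unfolding split norm_mult
          by (intro mult_mono norm_prod_le_prod_norm prod_norm_nonneg norm_ge_zero)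
      qed
      hence "c * prod_norm N (n + m) \<omega> \<le> c * (prod_norm N n \<psi> * prod_norm N m \<phi>)"
        using c0 by (rule mult_left_mono)
      moreover have "(\<Prod>i<n + m. dualnorm N (\<omega> i)) \<le> c * prod_norm N (n + m) \<omega>"
        using c by (auto simp: pol_bounds_def)
      ultimately have "(\<Prod>i<n. dualnorm N (\<psi> i)) * ?d \<le> c * (prod_norm N n \<psi> * prod_norm N m \<phi>)"
        unfolding split by linarith
      thus "(\<Prod>i<n. dualnorm N (\<psi> i)) \<le> c * prod_norm N m \<phi> / ?d * prod_norm N n \<psi>"
        using d by (simp add: field_simps)
    qed
    from lin_pol_const_le[OF this] have "?c \<le> c * prod_norm N m \<phi> / ?d" .
    thus ?thesis using d c1 by (simp add: field_simps)
  qed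
  hence "c / ?c \<in> pol_bounds m" by (simp add: pol_bounds_def)
  from lin_pol_const_le[OF this] show ?thesis using c1 by (simp add: field_simps)
qed

text \<open>Almost everywhere the sum of the logarithms is at most the logarithm of the norm of the
  product. Integration keeps the right side, and on the left each functional contributes at least
  \<open>- U\<close>.\<close>

lemma upper_bound_imp_mem_pol_bounds:
  assumes mu: "prob_space \<mu>" and adm: "admissible N (unit_sphere N) \<mu>"
    and U: "\<And>\<psi>. dualnorm N \<psi> = 1 \<Longrightarrow> - U \<le> (\<integral>x. ln (norm (pair x \<psi>)) \<partial>\<mu>)"
  shows "exp (real n * U) \<in> pol_bounds n"
proof (rule pol_boundsI)
  fix \<psi> :: "nat \<Rightarrow> 'k ^ 'n"
  assume \<psi>: "\<And>i. i < n \<Longrightarrow> dualnorm N (\<psi> i) = 1"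
  interpret prob_space \<mu> by (rule mu)
  let ?S = "unit_sphere (dualnorm N)" and ?P = "prod_norm N n \<psi>"
  have S: "\<forall>\<phi>\<in>?S. 1 \<le> dualnorm N \<phi> \<and> dualnorm N \<phi> \<le> 1" by (simp add: unit_sphere_def)
  have mem: "\<psi> i \<in> ?S" if "i < n" for i using \<psi>[OF that] by (simp add: unit_sphere_def)
  note facts = N mu adm zero_less_one S
  have "AE x in \<mu>. \<forall>i\<in>{..<n}. pair x (\<psi> i) \<noteq> 0"
    by (intro AE_finite_allI AE_pair_neq_0[OF facts]) (auto simp: mem)
  hence bound: "AE x in \<mu>. 0 < ?P \<and> (\<Sum>i<n. ln (norm (pair x (\<psi> i)))) \<le> ln ?P"
    using AE_space
  proof eventually_elim
    case (elim x)
    have "N x = 1" using elim(2) space_admissible[OF facts] by (simp add: unit_sphere_def)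
    hence le: "norm (\<Prod>i<n. pair x (\<psi> i)) \<le> ?P" by (rule norm_prod_le_prod_norm)
    have pos: "0 < norm (\<Prod>i<n. pair x (\<psi> i))" using elim(1) by auto
    have "(\<Sum>i<n. ln (norm (pair x (\<psi> i)))) = ln (norm (\<Prod>i<n. pair x (\<psi> i)))"
      using elim(1) by (subst prod_norm[symmetric], subst ln_prod) auto
    also have "\<dots> \<le> ln ?P" using le pos by (intro ln_mono) linarith+
    finally show ?case using le pos by linarith
  qed
  have "AE x in \<mu>. 0 < ?P" using bound by eventually_elim auto
  \<comment> \<open>A statement free of \<open>x\<close> that holds almost everywhere is true, since
    \<mu> is a probability measure. So the norm is positive without exhibiting a point at which no
    functional vanishes.\<close>
  hence pos: "0 < ?P" by simp
  have int: "integrable \<mu> (\<lambda>x. ln (norm (pair x (\<psi> i))))" if "i < n" for i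
    by (rule integrable_ln_pair[OF facts mem[OF that]])
  have "- (real n * U) = (\<Sum>i<n. - U)" by simp
  also have "\<dots> \<le> (\<Sum>i<n. \<integral>x. ln (norm (pair x (\<psi> i))) \<partial>\<mu>)" using U \<psi> by (intro sum_mono) auto
  also have "\<dots> = (\<integral>x. (\<Sum>i<n. ln (norm (pair x (\<psi> i)))) \<partial>\<mu>)" 
    using int by (intro Bochner_Integration.integral_sum[symmetric]) auto
  also have "\<dots> \<le> (\<integral>x. ln ?P \<partial>\<mu>)"
    using bound int by (intro integral_mono_AE Bochner_Integration.integrable_sum) auto
  also have "\<dots> = ln ?P" by (simp add: prob_space)
  finally have "exp (- (real n * U)) \<le> ?P" using pos by (simp add: ln_ge_iff)
  hence "exp (real n * U) * exp (- (real n * U)) \<le> exp (real n * U) * ?P" by (intro mult_left_mono) auto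
  thus "1 \<le> exp (real n * U) * ?P" by (simp flip: exp_add)
qed simp

text \<open>The functionals are drawn from a finite net, each one about \<open>n\<close> times the mass of its cell.\<close>

lemma lower_bound_pol_bounds:
  assumes eta: "prob_space \<eta>" and adm: "admissible (dualnorm N) (unit_sphere (dualnorm N)) \<eta>"
    and \<beta>: "\<And>x. N x = 1 \<Longrightarrow> (\<integral>\<psi>. ln (norm (pair x \<psi>)) \<partial>\<eta>) \<le> - \<beta>" and \<epsilon>: "\<epsilon> > 0"
  obtains \<gamma> where "\<And>n. \<exists>n'\<le>n. \<forall>c\<in>pol_bounds n'. exp (real n * (\<beta> - \<epsilon>) - \<gamma>) \<le> c"
proof -
  interpret prob_space \<eta> by (rule eta)
  let ?S = "unit_sphere N"
  obtain r where r: "0 < r" and S: "\<forall>x\<in>?S. r \<le> dualnorm (dualnorm N) x \<and> dualnorm (dualnorm N) x \<le> 1"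
    using bidual_bounds[OF N] by blast
  note facts = dual_is_norm eta adm r S
  have sp: "space \<eta> = unit_sphere (dualnorm N)" by (rule space_admissible[OF facts])
  obtain m where m: "m \<ge> 0" "\<And>x. x \<in> ?S \<Longrightarrow>
      - (\<integral>y. ln (norm (pair y x)) \<partial>\<eta>) \<le> (\<integral>y. cut m (norm (pair y x)) \<partial>\<eta>) + \<epsilon> / 2"
    using uniform_cut_approx[OF facts, of "\<epsilon> / 2"] \<epsilon> by auto
  \<comment> \<open>Balances the Lipschitz constant of \<open>cut m\<close>: moving to a net point
    at distance below \<delta> changes the integrand by at most \<epsilon>/2. The other half of
    \<epsilon> is the truncation error.\<close>
  define \<delta> where "\<delta> = \<epsilon> / (2 * exp m)"
  have \<delta>: "\<delta> > 0" using \<epsilon> by (simp add: \<delta>_def)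
  have open_ball: "open {y. dualnorm N (y - v) < \<delta>}" for v
    by (intro open_Collect_less continuous_on_compose2[OF continuous_on_norm[OF dual_is_norm, of UNIV]] continuous_intros) auto
  have "unit_sphere (dualnorm N) \<subseteq> (\<Union>v\<in>unit_sphere (dualnorm N). {y. dualnorm N (y - v) < \<delta>})"
    using \<delta> is_norm_eq_0[OF dual_is_norm, of 0] by force
  then obtain F
    where F: "F \<subseteq> unit_sphere (dualnorm N)" "finite F" "unit_sphere (dualnorm N) \<subseteq> (\<Union>v\<in>F. {y. dualnorm N (y - v) < \<delta>})"
    by (rule compactE_image[OF compact_unit_sphere[OF dual_is_norm] open_ball])
  define J where "J = card F"
  obtain v where vF: "bij_betw v {0..<J} F" unfolding J_def using ex_bij_betw_nat_finite[OF F(2)] by blast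
  have v: "dualnorm N (v j) = 1" if "j < J" for j
    using bij_betwE[OF vF] that F(1) by (auto simp: unit_sphere_def)
  define B where "B j = {y \<in> space \<eta>. dualnorm N (y - v j) < \<delta>}" for j
  \<comment> \<open>Disjoint cells have total mass at most 1, which is what bounds the number of
    functionals drawn by n.\<close>
  define A where "A = disjointed B"
  have cover: "space \<eta> \<subseteq> (\<Union>j\<in>{0..<J}. A j)"
  proof
    fix y assume y: "y \<in> space \<eta>"
    then obtain w where "w \<in> F" "dualnorm N (y - w) < \<delta>" using F(3) sp by auto
    then obtain j where "j < J" "w = v j" using vF by (auto simp: bij_betw_def)
    hence "y \<in> (\<Union>j\<in>{0..<J}. B j)" using y \<open>dualnorm N (y - w) < \<delta>\<close> by (auto simp: B_def)
    thus "y \<in> (\<Union>j\<in>{0..<J}. A j)" unfolding A_def finite_UN_disjointed_eq .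
  qed
  have meas: "A j \<in> sets \<eta>" for j
  proof -
    have "B j \<in> sets \<eta>" for j
    proof -
      have "(\<lambda>y. dualnorm N (y - v j)) \<in> borel_measurable \<eta>"
        by (intro measurable_admissible[OF facts] borel_measurable_continuous_onI
            continuous_on_compose2[OF continuous_on_norm[OF dual_is_norm, of UNIV]] continuous_intros) auto
      thus ?thesis unfolding B_def by measurable
    qed
    hence "range (disjointed B) \<subseteq> sets \<eta>" by (intro sets.range_disjointed_sets) blast
    thus ?thesis unfolding A_def by blast
  qed
  define p where "p j = prob (A j)" for j
  have p0: "0 \<le> p j" for j by (simp add: p_def)
  have "(\<Sum>j<J. p j) = prob (\<Union>j<J. A j)"
    unfolding p_def using disjoint_family_disjointed[of B] meas
    by (intro finite_measure_finite_Union[symmetric]) (auto simp: A_def disjoint_family_on_def)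
  hence p1: "(\<Sum>j<J. p j) \<le> 1" by simp
  define h where "h x j = cut m (norm (pair (v j) x))" for x j
  have h: "0 \<le> h x j" "h x j \<le> m" if "N x = 1" "j < J" for x j
  proof -
    have "norm (pair (v j) x) \<le> 1"
      using norm_pair_le[OF N, of x "v j"] that v[OF that(2)] by (simp add: pair_commute)
    thus "0 \<le> h x j" "h x j \<le> m" using m(1) by (simp_all add: h_def cut_nonneg cut_le)
  qed
  have approx: "(\<integral>y. cut m (norm (pair y x)) \<partial>\<eta>) \<le> (\<Sum>j<J. p j * h x j) + \<epsilon> / 2" if x: "N x = 1" for x
  proof -
    have xS: "x \<in> ?S" using x by (simp add: unit_sphere_def)
    have int: "integrable \<eta> (\<lambda>y. indicator (A j) y * h x j)" for j
      using meas by (intro integrable_mult_left integrable_real_indicator) (auto simp: emeasure_eq_measure)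
    have "(\<integral>y. cut m (norm (pair y x)) \<partial>\<eta>) \<le> (\<integral>y. (\<Sum>j<J. indicator (A j) y * h x j) + \<epsilon> / 2 \<partial>\<eta>)"
    proof (rule integral_mono)
      show "integrable \<eta> (\<lambda>y. cut m (norm (pair y x)))"
        using S[rule_format, OF xS] m(1) by (intro integrable_cut[OF facts]) auto
      show "integrable \<eta> (\<lambda>y. (\<Sum>j<J. indicator (A j) y * h x j) + \<epsilon> / 2)"
        using int by (intro Bochner_Integration.integrable_add Bochner_Integration.integrable_sum) auto
      fix y assume y: "y \<in> space \<eta>"
      then obtain j where j: "j < J" "y \<in> A j" using cover by auto
      hence d: "dualnorm N (y - v j) < \<delta>" using disjointed_subset[of B j] by (auto simp: A_def B_def)
      have "\<bar>norm (pair y x) - norm (pair (v j) x)\<bar> \<le> norm (pair x (y - v j))"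
        unfolding pair_commute[of x] pair_simps by (rule norm_triangle_ineq3)
      also have "\<dots> \<le> \<delta>" using norm_pair_le[OF N, of x "y - v j"] x d by simp
      finally have "exp m * \<bar>norm (pair y x) - norm (pair (v j) x)\<bar> \<le> exp m * \<delta>"
        by (intro mult_left_mono) auto
      hence "cut m (norm (pair y x)) \<le> h x j + \<epsilon> / 2"
        using cut_lipschitz[of m "norm (pair y x)" "norm (pair (v j) x)"] by (simp add: h_def \<delta>_def)
      also have "h x j = indicator (A j) y * h x j" using j by simp
      also have "\<dots> \<le> (\<Sum>j<J. indicator (A j) y * h x j)"
        using j h[OF x] by (intro member_le_sum) auto
      finally show "cut m (norm (pair y x)) \<le> (\<Sum>j<J. indicator (A j) y * h x j) + \<epsilon> / 2" by simp
    qed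
    also have "\<dots> = (\<integral>y. (\<Sum>j<J. indicator (A j) y * h x j) \<partial>\<eta>) + (\<integral>y. \<epsilon> / 2 \<partial>\<eta>)"
      by (intro Bochner_Integration.integral_add Bochner_Integration.integrable_sum int) simp
    also have "(\<integral>y. (\<Sum>j<J. indicator (A j) y * h x j) \<partial>\<eta>) = (\<Sum>j<J. \<integral>y. indicator (A j) y * h x j \<partial>\<eta>)"
      by (rule Bochner_Integration.integral_sum) (rule int)
    also have "\<dots> = (\<Sum>j<J. p j * h x j)"
      using sets.Int_space_eq2[OF meas] by (intro sum.cong) (simp_all add: p_def)
    also have "(\<integral>y. \<epsilon> / 2 \<partial>\<eta>) = \<epsilon> / 2" by (simp add: prob_space)
    finally show ?thesis .
  qed
  have "\<exists>n'\<le>n. \<forall>c\<in>pol_bounds n'. exp (real n * (\<beta> - \<epsilon>) - real J * m) \<le> c" for n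
  proof -
    \<comment> \<open>Rounding down keeps the total within n. Each cell loses less than one
      functional, hence at most \<open>m\<close> in the exponent because \<open>h x j\<close> lies
      between 0 and \<open>m\<close>; over all cells this is the constant \<open>real J * m\<close>,
      which becomes \<gamma>.\<close>
    define k where "k j = nat \<lfloor>real n * p j\<rfloor>" for j
    have k: "real (k j) \<le> real n * p j" "real n * p j - 1 \<le> real (k j)" for j
    proof -
      have "0 \<le> real n * p j" using p0 by simp
      thus "real (k j) \<le> real n * p j" "real n * p j - 1 \<le> real (k j)" unfolding k_def by linarith+
    qed
    define n' where "n' = sum k {..<J}"
    have "real n' \<le> (\<Sum>j<J. real n * p j)" unfolding n'_def of_nat_sum using k by (intro sum_mono)
    also have "\<dots> \<le> real n * 1" unfolding sum_distrib_left[symmetric] using p1 by (intro mult_left_mono) auto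
    finally have n': "n' \<le> n" by simp
    obtain \<sigma> where \<sigma>: "\<And>i. i < n' \<Longrightarrow> \<sigma> i \<in> {..<J}"
      "\<And>f. (\<Prod>i<n'. f (\<sigma> i)) = (\<Prod>j<J. f j ^ k j :: real)"
      unfolding n'_def using ex_map_with_fibre_cards[OF finite_lessThan[of J], of k] by blast
    define \<psi> where "\<psi> i = v (\<sigma> i)" for i
    let ?E = "real n * (\<beta> - \<epsilon>) - real J * m"
    have P: "prod_norm N n' \<psi> \<le> exp (- ?E)"
    proof (rule prod_norm_le)
      fix x assume x: "N x = 1"
      have xS: "x \<in> ?S" using x by (simp add: unit_sphere_def)
      have "norm (\<Prod>i<n'. pair x (\<psi> i)) = (\<Prod>j<J. norm (pair (v j) x) ^ k j)"
        using \<sigma>(2)[of "\<lambda>j. norm (pair (v j) x)"] by (simp add: \<psi>_def prod_norm pair_commute)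
      also have "\<dots> \<le> (\<Prod>j<J. exp (- h x j) ^ k j)"
        by (intro prod_mono conjI power_mono zero_le_power) (auto simp: h_def le_exp_cut)
      also have "\<dots> = exp (- (\<Sum>j<J. real (k j) * h x j))"
        by (simp add: exp_sum sum_negf[symmetric] exp_of_nat_mult[symmetric])
      also have "\<dots> \<le> exp (- ?E)"
      proof -
        have "real n * (\<beta> - \<epsilon>) \<le> real n * (\<Sum>j<J. p j * h x j)"
        proof (rule mult_left_mono)
          have "\<beta> \<le> - (\<integral>y. ln (norm (pair y x)) \<partial>\<eta>)" using \<beta>[OF x] by (simp add: pair_commute)
          thus "\<beta> - \<epsilon> \<le> (\<Sum>j<J. p j * h x j)" using m(2)[OF xS] approx[OF x] by (simp add: field_simps)
        qed simp
        also have "\<dots> - real J * m = (\<Sum>j<J. real n * p j * h x j - m)"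
          by (simp add: sum_subtractf sum_distrib_left mult.assoc)
        hence "real n * (\<Sum>j<J. p j * h x j) = (\<Sum>j<J. real n * p j * h x j - m) + real J * m"
          by simp
        also have "(\<Sum>j<J. real n * p j * h x j - m) \<le> (\<Sum>j<J. real (k j) * h x j)"
        proof (rule sum_mono)
          fix j assume "j \<in> {..<J}"
          hence "0 \<le> h x j" "h x j \<le> m" using h[OF x] by auto
          moreover have "(real n * p j - 1) * h x j \<le> real (k j) * h x j"
            using k(2) calculation(1) by (rule mult_right_mono)
          ultimately show "real n * p j * h x j - m \<le> real (k j) * h x j" by (simp add: algebra_simps)
        qed
        finally show ?thesis by simp
      qed
      finally show "norm (\<Prod>i<n'. pair x (\<psi> i)) \<le> exp (- ?E)" .
    qed
    have "exp ?E \<le> c" if c: "c \<in> pol_bounds n'" for c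
    proof -
      have "(\<Prod>i<n'. dualnorm N (\<psi> i)) = 1" using v \<sigma>(1) by (intro prod.neutral) (auto simp: \<psi>_def)
      moreover have "(\<Prod>i<n'. dualnorm N (\<psi> i)) \<le> c * prod_norm N n' \<psi>" using c by (simp add: pol_bounds_def)
      ultimately have "1 \<le> c * prod_norm N n' \<psi>" by simp
      also have "\<dots> \<le> c * exp (- ?E)" using P pol_bounds_ge_1[OF c] by (intro mult_left_mono) auto
      finally have "exp ?E * 1 \<le> exp ?E * (c * exp (- ?E))" by (intro mult_left_mono) auto
      also have "\<dots> = c * exp (?E + - ?E)" unfolding exp_add by (simp only: mult_ac)
      finally show ?thesis by simp
    qed
    thus ?thesis using n' by blast
  qed
  thus ?thesis by (rule that)
qed

text \<open>The hypothesis makes every set of bounds nonempty; the logarithms of c_n are then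
  nonnegative, superadditive and at most linear, so Fekete's lemma applies. Convergence is what ties
  \<open>lim\<close> in the definition of \<open>pol_const\<close> to an actual limit.\<close>

lemma tendsto_pol_const:
  assumes U: "\<And>n. exp (real n * U) \<in> pol_bounds n"
  shows "(\<lambda>n. exp (ln (lin_pol_const N n) / real n)) \<longlonglongrightarrow> pol_const N"
    and "m \<le> n \<Longrightarrow> lin_pol_const N m \<le> lin_pol_const N n"
    and "1 \<le> lin_pol_const N n" and "lin_pol_const N n \<le> exp (real n * U)"
proof -
  let ?c = "lin_pol_const N"
  show c1: "1 \<le> ?c n" for n
    unfolding lin_pol_const_eq using U pol_bounds_ge_1 by (intro cInf_greatest) auto
  have mult: "?c n * ?c m \<le> ?c (n + m)" for n m
    using U unfolding lin_pol_const_eq[of "n + m"] by (intro cInf_greatest pol_bounds_add) auto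
  show upper: "?c n \<le> exp (real n * U)" for n
    using U by (rule lin_pol_const_le)
  show "?c m \<le> ?c n" if "m \<le> n"
  proof -
    have "?c m * 1 \<le> ?c m * ?c (n - m)" using c1[of m] c1[of "n - m"] by (intro mult_left_mono) auto
    also have "\<dots> \<le> ?c n" using mult[of m "n - m"] that by simp
    finally show ?thesis by simp
  qed
  have pos: "0 < ?c n" for n using c1[of n] by simp
  have "convergent (\<lambda>n. ln (?c n) / real n)"
  proof (rule fekete_superadditive)
    show "ln (?c m) + ln (?c n) \<le> ln (?c (m + n))" for m n
      using mult[of m n] pos[of m] pos[of n] by (simp add: ln_mult_pos[symmetric] ln_mono)
    show "0 \<le> ln (?c n)" for n using c1 by simp
    show "ln (?c n) \<le> real n * U" for n
      using upper[of n] pos[of n] by (metis ln_exp ln_mono)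
  qed
  then obtain L where "(\<lambda>n. ln (?c n) / real n) \<longlonglongrightarrow> L" by (auto simp: convergent_def)
  hence lim: "(\<lambda>n. exp (ln (?c n) / real n)) \<longlonglongrightarrow> exp L" by (intro tendsto_intros)
  \<comment> \<open>Also at \<open>n = 0\<close>: division by zero yields 0, so both sides are
    1.\<close>
  moreover have "(\<lambda>n. ?c n powr (1 / real n)) = (\<lambda>n. exp (ln (?c n) / real n))"
    using pos by (intro ext) (simp add: powr_def less_imp_neq[THEN not_sym])
  ultimately have "pol_const N = exp L" unfolding pol_const_def by (simp add: limI)
  thus "(\<lambda>n. exp (ln (?c n) / real n)) \<longlonglongrightarrow> pol_const N" using lim by simp
qed

end

theorem theorem1p2:
  fixes N :: "'k::real_normed_field ^ 'n \<Rightarrow> real"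
    and \<mu> \<eta> :: "('k ^ 'n) measure"
  assumes "is_norm N"
    and "prob_space \<mu>" and "admissible N (unit_sphere N) \<mu>"
    and "prob_space \<eta>" and "admissible (dualnorm N) (unit_sphere (dualnorm N)) \<eta>"
  shows "\<exists>\<psi>0 x0. \<psi>0 \<in> unit_sphere (dualnorm N) \<and> x0 \<in> unit_sphere N \<and>
     exp (- (\<integral>\<psi>. ln (norm (pair x0 \<psi>)) \<partial>\<eta>)) \<le> pol_const N \<and>
     pol_const N \<le> exp (- (\<integral>x. ln (norm (pair x \<psi>0)) \<partial>\<mu>))"
proof -
  note N = assms(1) and D = is_norm_dualnorm[OF assms(1)]
  let ?G = "\<lambda>\<psi>. \<integral>x. ln (norm (pair x \<psi>)) \<partial>\<mu>" and ?H = "\<lambda>x. \<integral>\<psi>. ln (norm (pair x \<psi>)) \<partial>\<eta>"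
  let ?S = "unit_sphere N" and ?D = "unit_sphere (dualnorm N)"
  have "\<forall>\<psi>\<in>?D. 1 \<le> dualnorm N \<psi> \<and> dualnorm N \<psi> \<le> 1" by (simp add: unit_sphere_def)
  from continuous_on_integral_ln[OF N assms(2,3) zero_less_one this]
  obtain \<psi>0 where \<psi>0: "\<psi>0 \<in> ?D" "\<And>\<psi>. \<psi> \<in> ?D \<Longrightarrow> ?G \<psi>0 \<le> ?G \<psi>"
    using continuous_attains_inf[OF compact_unit_sphere[OF D] unit_sphere_nonempty[OF D]] by blast
  obtain r where r: "0 < r" "\<forall>x\<in>?S. r \<le> dualnorm (dualnorm N) x \<and> dualnorm (dualnorm N) x \<le> 1"
    using bidual_bounds[OF N] by blast
  \<comment> \<open>The roles are exchanged: \<eta> lives on the dual sphere, so the points of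
    \<open>?S\<close> act as functionals, with bidual norms known only to lie between
    \<open>r\<close> and 1.\<close>
  have "continuous_on ?S ?H"
    using continuous_on_integral_ln[OF D assms(4,5) r] by (simp add: pair_commute)
  then obtain x0 where x0: "x0 \<in> ?S" "\<And>x. x \<in> ?S \<Longrightarrow> ?H x \<le> ?H x0"
    using continuous_attains_sup[OF compact_unit_sphere[OF N] unit_sphere_nonempty[OF N]] by blast
  \<comment> \<open>Minimality of \<psi>0 supplies one constant \<open>U\<close> for all unit
    functionals, and thereby for all n.\<close>
  have U: "exp (real n * - ?G \<psi>0) \<in> pol_bounds N n" for n
    by (rule upper_bound_imp_mem_pol_bounds[OF N assms(2,3)]) (use \<psi>0(2) in \<open>simp add: unit_sphere_def\<close>)
  note lim = tendsto_pol_const(1)[OF N U] and c1 = tendsto_pol_const(3)[OF N U]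
    and mono = tendsto_pol_const(2)[OF N U] and upper = tendsto_pol_const(4)[OF N U]
  have "pol_const N \<le> exp (- ?G \<psi>0)"
  proof (rule LIMSEQ_le_const2[OF lim])
    have "exp (ln (lin_pol_const N n) / real n) \<le> exp (- ?G \<psi>0)" if "n \<ge> 1" for n
    proof -
      have "ln (lin_pol_const N n) \<le> real n * - ?G \<psi>0"
        using upper[of n] c1[of n] by (metis ln_exp ln_mono less_le_trans zero_less_one)
      thus ?thesis using that by (simp add: field_simps)
    qed
    thus "\<exists>n0. \<forall>n\<ge>n0. exp (ln (lin_pol_const N n) / real n) \<le> exp (- ?G \<psi>0)" by blast
  qed
  moreover have "exp (- ?H x0) \<le> pol_const N"
  proof -
    \<comment> \<open>The error terms go away in turn: \<gamma> is independent of n and disappears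
      in the limit defining \<open>pol_const\<close>; afterwards \<epsilon> tends to 0 along the
      reciprocals of the positive integers.\<close>
    have le: "exp (- ?H x0 - \<epsilon>) \<le> pol_const N" if "\<epsilon> > 0" for \<epsilon>
    proof -
      have "?H x \<le> - (- ?H x0)" if "N x = 1" for x using x0(2)[of x] that by (simp add: unit_sphere_def)
      from lower_bound_pol_bounds[OF N assms(4,5) this \<open>\<epsilon> > 0\<close>]
      obtain \<gamma> where \<gamma>: "\<And>n. \<exists>n'\<le>n. \<forall>c\<in>pol_bounds N n'. exp (real n * (- ?H x0 - \<epsilon>) - \<gamma>) \<le> c"
        by blast
      have "exp (- ?H x0 - \<epsilon> - \<gamma> / real n) \<le> exp (ln (lin_pol_const N n) / real n)" if "n \<ge> 1" for n
      proof -
        obtain n' where n': "n' \<le> n" "\<And>c. c \<in> pol_bounds N n' \<Longrightarrow> exp (real n * (- ?H x0 - \<epsilon>) - \<gamma>) \<le> c"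
          using \<gamma> by blast
        have "exp (real n * (- ?H x0 - \<epsilon>) - \<gamma>) \<le> lin_pol_const N n'"
          unfolding lin_pol_const_eq[OF N] using U n'(2) by (intro cInf_greatest) auto
        also have "\<dots> \<le> lin_pol_const N n" by (rule mono[OF n'(1)])
        finally have "real n * (- ?H x0 - \<epsilon>) - \<gamma> \<le> ln (lin_pol_const N n)"
          using c1[of n] by (simp add: ln_ge_iff)
        hence "(real n * (- ?H x0 - \<epsilon>) - \<gamma>) / real n \<le> ln (lin_pol_const N n) / real n"
          by (rule divide_right_mono) simp
        thus ?thesis using that by (simp add: diff_divide_distrib)
      qed
      moreover have "(\<lambda>n. exp (- ?H x0 - \<epsilon> - \<gamma> / real n)) \<longlonglongrightarrow> exp (- ?H x0 - \<epsilon> - 0)"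
        by (intro tendsto_intros lim_const_over_n)
      ultimately show ?thesis using LIMSEQ_le[OF _ lim] by force
    qed
    have "(\<lambda>n. exp (- ?H x0 - 1 / real (Suc n))) \<longlonglongrightarrow> exp (- ?H x0 - 0)"
      by (intro tendsto_intros LIMSEQ_Suc[OF lim_const_over_n])
    thus ?thesis using le by (intro LIMSEQ_le_const2) auto
  qed
  ultimately show ?thesis using \<psi>0(1) x0(1) by blast
qed

end
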